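(* Let $R\in(1,\infty)$. The shapes $i_\varrho(T_R)$, $\varrho\in[0,R-1)$, are pairwise distinct. Moreover: (1) If $R\ne\sqrt2$, then the shapes $i_\varrho(T_R)$, $\varrho\in[0,R-1)\cup(R-1,\sqrt{R^2-1}]$, are pairwise distinct. (2) If $R=\sqrt2$, then the parameters $\varrho>\sqrt2-1$ (with $\varrho\neq\sqrt2+1$) add no new shape: each such $i_\varrho(T_{\sqrt2})$ equals $i_{\varrho'}(T_{\sqrt2})$ for some $\varrho'\in[0,\sqrt2-1)$. Hence the shape space $$\{i_{(x,y,z)}(T_{\sqrt2}): (x,y,z)\in\mathbb{R}^3\setminus T_{\sqrt2}\}\big/{\rm Hom}(3)$$ is in one-to-one correspondence with $\{i_\varrho(T_{\sqrt2}):\varrho\in[0,\sqrt2-1)\}$.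
   Context: For $R>1$, $T_R=\{((R+\cos v)\cos u,(R+\cos v)\sin u,\sin v):u,v\in[0,2\pi]\}\subset\mathbb{R}^3$. For $\mathbf a\in\mathbb{R}^3$, $i_{\mathbf a}(\mathbf x)=\mathbf a+(\mathbf x-\mathbf a)/\|\mathbf x-\mathbf a\|^2$ is inversion in the unit sphere centered at $\mathbf a$. "Homothety" means a similarity of $\mathbb{R}^3$ (a composition of rigid motions, reflections and uniform scalings). "$/{\rm Hom}(3)$" means that two point sets are identified when one is carried to the other by a homothety. A "shape" is an equivalence class under this identification. For $0<\varrho<\infty$, let $\mathcal C(\varrho;R)$ be the circle in the $(\rho,z)$ half-plane having as a diameter the segment joining $(\varrho,0)$ and $((R^2-1)/\varrho,0)$ (a single point when $\varrho=\sqrt{R^2-1}$). Let $\mathcal C(0;R)=\mathcal C(\infty;R)$ be the $z$-axis. Let $\mathcal T(\varrho;R)=\{(\rho\cos\theta,\rho\sin\theta,z):(\rho,z)\in\mathcal C(\varrho;R),\theta\in[0,2\pi]\}$. For $\varrho\in[0,\infty]\setminus\{R-1,R+1\}$, all surfaces $i_{(x,y,z)}(T_R)$ with $(x,y,z)\in\mathcal T(\varrho;R)$ are homothetic, and $i_\varrho(T_R)$ denotes their common shape; in particular, for finite $\varrho$, it is the shape of $i_{(\varrho,0,0)}(T_R)$. *)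

theory Defs
  imports "HOL-Analysis.Analysis"
begin

definition torus :: "real \<Rightarrow> (real^3) set" where
  "torus R = {vector [(R + cos v) * cos u, (R + cos v) * sin u, sin v] | u v.
     u \<in> {0..2 * pi} \<and> v \<in> {0..2 * pi}}"

text \<open>Inversion in the unit sphere centred at \<open>a\<close>; the value at \<open>a\<close> itself is meaningless.\<close>

definition inversion :: "real^3 \<Rightarrow> real^3 \<Rightarrow> real^3" where
  "inversion a x = a + (1 / (norm (x - a))\<^sup>2) *\<^sub>R (x - a)"

text \<open>A homothety is a similarity: a uniform scaling, followed by an orthogonal map (proper or
  improper), followed by a translation. By \<open>homothety_iff_dist\<close> below, these are exactly the maps scaling
  all distances by a constant positive factor.\<close>

definition homothety :: "(real^3 \<Rightarrow> real^3) \<Rightarrow> bool" where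
  "homothety f \<longleftrightarrow>
     (\<exists>b c U. c > 0 \<and> orthogonal_transformation U \<and> f = (\<lambda>x. b + U (c *\<^sub>R x)))"

definition homothetic :: "((real^3) set \<times> (real^3) set) set" where
  "homothetic = {(X, Y). \<exists>f. homothety f \<and> Y = f ` X}"

lemma homothety_iff_dist:
  "homothety f \<longleftrightarrow> (\<exists>c>0. \<forall>x y. dist (f x) (f y) = c * dist x y)"
proof
  assume "homothety f"
  then obtain b c U where "c > 0" and U: "orthogonal_transformation U"
    and f: "f = (\<lambda>x. b + U (c *\<^sub>R x))"
    unfolding homothety_def by blast
  have "dist (f x) (f y) = c * dist x y" for x y
  proof -
    have "dist (f x) (f y) = dist (U (c *\<^sub>R x)) (U (c *\<^sub>R y))"
      by (simp add: f)
    also have "\<dots> = dist (c *\<^sub>R x) (c *\<^sub>R y)"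
      using U by (simp add: orthogonal_transformation_isometry)
    also have "\<dots> = c * dist x y"
      using \<open>c > 0\<close> by (simp add: dist_norm flip: scaleR_right_diff_distrib)
    finally show ?thesis .
  qed
  with \<open>c > 0\<close> show "\<exists>c>0. \<forall>x y. dist (f x) (f y) = c * dist x y" by blast
next
  assume "\<exists>c>0. \<forall>x y. dist (f x) (f y) = c * dist x y"
  then obtain c where "c > 0" and d: "\<And>x y. dist (f x) (f y) = c * dist x y" by blast
  define U where "U = (\<lambda>x. f (inverse c *\<^sub>R x) - f 0)"
  have "U 0 = 0" by (simp add: U_def)
  moreover have "dist (U x) (U y) = dist x y" for x y
  proof -
    have "dist (U x) (U y) = c * dist (inverse c *\<^sub>R x) (inverse c *\<^sub>R y)"
      using d[of "inverse c *\<^sub>R x" "inverse c *\<^sub>R y"] by (simp add: U_def dist_norm)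
    also have "\<dots> = dist x y"
      using \<open>c > 0\<close> by (simp add: dist_norm flip: scaleR_right_diff_distrib)
    finally show ?thesis .
  qed
  ultimately have "orthogonal_transformation U"
    by (simp add: orthogonal_transformation_isometry)
  moreover have "f = (\<lambda>x. f 0 + U (c *\<^sub>R x))"
    using \<open>c > 0\<close> by (simp add: U_def fun_eq_iff)
  ultimately show "homothety f"
    unfolding homothety_def using \<open>c > 0\<close> by blast
qed

lemma equiv_homothetic: "equiv UNIV homothetic"
proof (intro equivI)
  show "homothetic \<subseteq> UNIV \<times> UNIV" by simp
  have "homothety (\<lambda>x. x)"
    unfolding homothety_iff_dist by (intro exI[of _ 1]) simp
  then show "refl homothetic"
    unfolding refl_on_def homothetic_def by force
  show "sym homothetic"
  proof (rule symI)
    fix X Y assume "(X, Y) \<in> homothetic"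
    then obtain f where f: "homothety f" and Y: "Y = f ` X"
      unfolding homothetic_def by blast
    from f obtain b c U where c: "c > 0" and U: "orthogonal_transformation U"
      and fe: "f = (\<lambda>x. b + U (c *\<^sub>R x))"
      unfolding homothety_def by blast
    from U have "surj U" by (rule orthogonal_transformation_surj)
    have surj: "surj f"
    proof (rule surjI)
      fix y
      show "f (inverse c *\<^sub>R inv U (y - b)) = y"
        using c \<open>surj U\<close> by (simp add: fe surj_f_inv_f)
    qed
    obtain k where k: "k > 0" and d: "\<And>x y. dist (f x) (f y) = k * dist x y"
      using f unfolding homothety_iff_dist by blast
    have inj: "inj f"
      using d k by (metis dist_eq_0_iff injI mult_eq_0_iff order_less_irrefl)
    have "dist (inv f x) (inv f y) = inverse k * dist x y" for x y
      using d[of "inv f x" "inv f y"] surj k by (simp add: surj_f_inv_f field_simps)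
    then have "homothety (inv f)"
      unfolding homothety_iff_dist using k by (intro exI[of _ "inverse k"]) simp
    moreover have "X = inv f ` Y"
      using inj by (simp add: Y image_inv_f_f)
    ultimately show "(Y, X) \<in> homothetic"
      unfolding homothetic_def by blast
  qed
  show "trans homothetic"
  proof (rule transI)
    fix X Y Z assume "(X, Y) \<in> homothetic" "(Y, Z) \<in> homothetic"
    then obtain f g where fg: "homothety f" "homothety g" "Y = f ` X" "Z = g ` Y"
      unfolding homothetic_def by blast
    from fg obtain k l where "k > 0" "\<And>x y. dist (f x) (f y) = k * dist x y"
      and "l > 0" "\<And>x y. dist (g x) (g y) = l * dist x y"
      unfolding homothety_iff_dist by blast
    then have "homothety (g \<circ> f)"
      unfolding homothety_iff_dist by (intro exI[of _ "l * k"]) simp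
    moreover have "Z = (g \<circ> f) ` X" using fg by (simp add: image_comp)
    ultimately show "(X, Z) \<in> homothetic"
      unfolding homothetic_def by blast
  qed
qed

definition shape :: "(real^3) set \<Rightarrow> (real^3) set set" where
  "shape X = homothetic `` {X}"

text \<open>The parameter \<open>r\<close> of the next three definitions ranges over \<open>[0, \<infinity>]\<close>. Pairs are points
  \<open>(\<rho>, z)\<close> of the closed half-plane \<open>\<rho> \<ge> 0\<close>. The sphere below is a single point
  if \<open>r = sqrt (R\<^sup>2 - 1)\<close>.\<close>

definition profile_circle :: "real \<Rightarrow> ereal \<Rightarrow> (real \<times> real) set" where
  "profile_circle R r =
     (if r = 0 \<or> r = \<infinity> then {(0, z) | z. True}
      else let p = (real_of_ereal r, 0); q = ((R\<^sup>2 - 1) / real_of_ereal r, 0)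
           in sphere (midpoint p q) (dist p q / 2))"

definition revolved_circle :: "real \<Rightarrow> ereal \<Rightarrow> (real^3) set" where
  "revolved_circle R r = {vector [\<rho> * cos \<theta>, \<rho> * sin \<theta>, z] | \<rho> \<theta> z.
     (\<rho>, z) \<in> profile_circle R r \<and> \<theta> \<in> {0..2 * pi}}"

text \<open>The common shape of all the surfaces \<open>inversion p ` torus R\<close> with \<open>p\<close> on
  \<open>revolved_circle R r\<close>. It exists for \<open>R > 1\<close> and \<open>r\<close> in \<open>[0, \<infinity>]\<close> other than
  \<open>R - 1\<close> and \<open>R + 1\<close>, for which \<open>revolved_circle R r\<close> would be the torus itself.\<close>

definition inverted_torus_shape :: "real \<Rightarrow> ereal \<Rightarrow> (real^3) set set" where
  "inverted_torus_shape R r =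
     (THE s. \<forall>p \<in> revolved_circle R r. shape (inversion p ` torus R) = s)"

end

theory Submission
  imports Defs
begin

text \<open>A Moebius map \<open>\<sigma>\<close> preserving the torus makes \<open>inversion p\<close> and \<open>inversion (\<sigma> p)\<close> yield the
  same shape. Rotations and the inversions in the spheres through the core circle centred on the axis act
  transitively on each \<open>revolved_circle R r\<close>; for \<open>R = sqrt 2\<close> a further Moebius map exchanges the two
  sides of the torus. Conversely, the inverted torus lies in a ball whose bounding sphere it touches
  along a circle, and the plane of that circle cuts the surface in exactly one more circle. The radii
  and centres of the two circles are determined by the surface up to scaling: the ratio of the radii
  determines \<open>r\<close> on each side of the torus, and the inversive distance of the circles tells the two
  sides apart unless \<open>R\<^sup>2 = 2\<close>.\<close>

section \<open>Inversions and shapes\<close>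

text \<open>Scaled by 1 / sqrt (R^2 - 1) and lifted to the 3-sphere by inverse stereographic
  projection, the torus becomes the product X1^2 + X2^2 = 1 - 1/R^2, X3^2 + X4^2 = 1/R^2. The
  revolved circles are the parallel products. The two factors have the same size exactly for R^2 =
  2, and then an exchange of the coordinate planes swaps the sides. For distinctness the obstacle is
  that a similarity between two inverted tori says nothing about single points, so the circles must
  be recovered from the bare point set. This dictates the choices: the centre p is taken on the
  x-axis, inside an open ball that avoids the torus, and in a symmetry plane through the centre of
  that ball. Inversion turns the outside of the ball into a ball and the circle of contact into a
  great circle of its boundary, so this is the smallest ball that encloses the surface. The
  inversive distance of two circles survives inversion and is therefore independent of p on each
  side.\<close>

lemma norm_sq_3: "(norm (x :: real^3))\<^sup>2 = (x$1)\<^sup>2 + (x$2)\<^sup>2 + (x$3)\<^sup>2"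
  by (simp add: power2_norm_eq_inner inner_vec_def sum_3 flip: power2_eq_square)

lemma shape_eq_iff: "shape X = shape Y \<longleftrightarrow> (\<exists>f. homothety f \<and> Y = f ` X)"
  unfolding shape_def using eq_equiv_class_iff[OF equiv_homothetic, of X Y]
  by (auto simp: homothetic_def)

text \<open>\<open>k\<close> is the squared radius. Division by zero yields the value
  \<open>q\<close> at \<open>q\<close>, so for \<open>k \<noteq> 0\<close> the map is an involution
  of the whole space.\<close>

definition sphere_inversion :: "real^3 \<Rightarrow> real \<Rightarrow> real^3 \<Rightarrow> real^3" where
  "sphere_inversion q k x = q + (k / (norm (x - q))\<^sup>2) *\<^sub>R (x - q)"

lemma inversion_eq_sphere_inversion: "inversion p = sphere_inversion p 1"
  by (simp add: fun_eq_iff inversion_def sphere_inversion_def)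

lemma sphere_inversion_involution:
  assumes "k \<noteq> 0"
  shows "sphere_inversion q k (sphere_inversion q k x) = x"
proof (cases "x = q")
  case False
  define N where "N = (norm (x - q))\<^sup>2"
  have "N \<noteq> 0" using False by (simp add: N_def)
  have "(norm ((k / N) *\<^sub>R (x - q)))\<^sup>2 = k\<^sup>2 / N"
    unfolding norm_scaleR power_mult_distrib power2_abs N_def[symmetric]
    using \<open>N \<noteq> 0\<close> by (simp add: power2_eq_square)
  then show ?thesis
    using assms \<open>N \<noteq> 0\<close> by (simp add: sphere_inversion_def power2_eq_square flip: N_def)
qed (simp add: sphere_inversion_def)

lemma sphere_inversion_eq_centre_iff: "k \<noteq> 0 \<Longrightarrow> sphere_inversion q k x = q \<longleftrightarrow> x = q"
  by (auto simp: sphere_inversion_def)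

lemma sphere_inversion_image_iff:
  assumes "k \<noteq> 0"
  shows "x \<in> sphere_inversion q k ` X \<longleftrightarrow> sphere_inversion q k x \<in> X"
  using sphere_inversion_involution[OF assms] by (metis image_iff)

lemma shape_inversion_orthogonal:
  assumes "orthogonal_transformation U"
  shows "shape (inversion (U p) ` (U ` X)) = shape (inversion p ` X)"
proof -
  have lin: "linear U" and n: "\<And>v. norm (U v) = norm v"
    using assms by (auto simp: orthogonal_transformation)
  have "inversion (U p) (U x) = U (inversion p x)" for x
    using n[of "x - p"] by (simp add: inversion_def linear_add[OF lin] linear_diff[OF lin] linear_scale[OF lin])
  then have "inversion (U p) ` (U ` X) = U ` (inversion p ` X)"
    by (auto simp: image_image)
  moreover have "homothety U"
    unfolding homothety_def using assms by (intro exI[of _ 0] exI[of _ 1] exI[of _ U]) simp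
  ultimately show ?thesis
    by (metis shape_eq_iff)
qed

text \<open>The composition \<open>inversion (\<sigma> p) \<circ> \<sigma> \<circ> inversion p\<close> fixes the point at infinity, so it is a
  similarity; its linear part is a multiple of the reflection in the plane orthogonal to \<open>p - q\<close>.\<close>

lemma shape_inversion_sphere_inversion:
  assumes "k > 0" "p \<noteq> q" "p \<notin> X" "q \<notin> X"
  shows "shape (inversion (sphere_inversion q k p) ` (sphere_inversion q k ` X)) = shape (inversion p ` X)"
proof -
  define d where "d = p - q"
  define p' where "p' = sphere_inversion q k p"
  define D where "D = d \<bullet> d"
  define S where "S = (\<lambda>v. v - (2 * (v \<bullet> d) / D) *\<^sub>R d)"
  \<comment> \<open>At \<open>y = p\<close>, where \<open>x\<close> is at infinity, the value must
    be \<open>inversion p' q\<close>, because \<open>sphere_inversion q k\<close> sends infinity to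
    \<open>q\<close>. This is the constant \<open>p' - (1 / k) *\<^sub>R d\<close>.\<close>
  define f where "f = (\<lambda>y. p' - (1 / k) *\<^sub>R d + (D / k) *\<^sub>R S (y - p))"
  have D: "D > 0" using assms by (simp add: D_def d_def)
  have "norm (S v) = norm v" for v
  proof -
    have "S v \<bullet> S v = v \<bullet> v"
      using D by (simp add: S_def inner_diff_left inner_diff_right inner_commute[of d v]
          field_simps power2_eq_square flip: D_def)
    then show ?thesis by (simp add: norm_eq_sqrt_inner)
  qed
  moreover have S_diff: "S v - S w = S (v - w)" for v w
    by (simp add: S_def inner_diff_left algebra_simps diff_divide_distrib)
  ultimately have "homothety f"
    unfolding homothety_iff_dist using D \<open>k > 0\<close>
    by (intro exI[of _ "D / k"])
      (simp add: f_def dist_norm S_diff flip: scaleR_right_diff_distrib)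
  moreover have "f (inversion p x) = inversion p' (sphere_inversion q k x)" if "x \<in> X" for x
  proof -
    define v where "v = x - p"
    define u where "u = v + d"
    define V where "V = v \<bullet> v"
    define W where "W = u \<bullet> u"
    have ne: "V \<noteq> 0" "W \<noteq> 0"
      using that assms by (auto simp: V_def W_def u_def v_def d_def)
    have W: "W = V + 2 * (v \<bullet> d) + D"
      by (simp add: W_def V_def D_def u_def inner_add_left inner_add_right inner_commute[of d v])
    have ud: "u \<bullet> d = v \<bullet> d + D" by (simp add: u_def D_def inner_add_left)
    have uq: "x - q = u" by (simp add: u_def v_def d_def)
    have "sphere_inversion q k x - p' = (k / W) *\<^sub>R u - (k / D) *\<^sub>R d"
      unfolding p'_def sphere_inversion_def uq d_def[symmetric]
      by (simp add: W_def D_def power2_norm_eq_inner)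
    \<comment> \<open>The square of the distance law |x' - p'| = k |x - p| / (|x - q| |p - q|) for
      images under an inversion.\<close>
    moreover have "(norm ((k / W) *\<^sub>R u - (k / D) *\<^sub>R d))\<^sup>2 = k\<^sup>2 * V / (W * D)"
    proof -
      have "(norm ((k / W) *\<^sub>R u - (k / D) *\<^sub>R d))\<^sup>2
          = (k / W)\<^sup>2 * W - 2 * (k / W) * (k / D) * (u \<bullet> d) + (k / D)\<^sup>2 * D"
        unfolding power2_norm_eq_inner inner_diff_left inner_diff_right inner_scaleR_left inner_scaleR_right
          inner_commute[of d u] W_def[symmetric] D_def[symmetric]
          by (simp add: power2_eq_square algebra_simps diff_divide_distrib)
      also have "\<dots> = k\<^sup>2 * (W + D - 2 * (u \<bullet> d)) / (W * D)"
        using ne D by (simp add: field_simps power2_eq_square)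
      also have "W + D - 2 * (u \<bullet> d) = V" by (simp add: W ud)
      finally show ?thesis .
    qed
    ultimately have "inversion p' (sphere_inversion q k x)
        = p' + (W * D / (k\<^sup>2 * V)) *\<^sub>R ((k / W) *\<^sub>R u - (k / D) *\<^sub>R d)"
      by (simp add: inversion_def)
    also have "\<dots> = p' + ((D / (k * V)) *\<^sub>R u - (W / (k * V)) *\<^sub>R d)"
      using ne D \<open>k > 0\<close> by (simp add: scaleR_right_diff_distrib power2_eq_square)
    also have "\<dots> = p' + ((D / (k * V)) *\<^sub>R v + ((D - W) / (k * V)) *\<^sub>R d)"
      by (simp add: u_def algebra_simps diff_divide_distrib)
    also have "(D - W) / (k * V) = - (1 / k) - 2 * (v \<bullet> d) / (k * V)"
      using ne \<open>k > 0\<close> by (simp add: W field_simps)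
    also have "p' + ((D / (k * V)) *\<^sub>R v + (- (1 / k) - 2 * (v \<bullet> d) / (k * V)) *\<^sub>R d)
       = f (inversion p x)"
    proof -
      have *: "inversion p x - p = (1 / V) *\<^sub>R v"
        by (simp add: inversion_def v_def V_def power2_norm_eq_inner)
      show ?thesis
        unfolding f_def * S_def using ne D \<open>k > 0\<close>
        by (simp add: scaleR_right_diff_distrib scaleR_diff_left mult.commute)
    qed
    finally show ?thesis by simp
  qed
  ultimately show ?thesis
    unfolding p'_def[symmetric] shape_eq_iff[of "inversion p ` X"] 
    by (subst eq_commute, subst shape_eq_iff) (auto simp: image_image intro!: exI[of _ f])
qed

section \<open>Shapes determined by two coplanar circles\<close>

definition circle :: "real^3 \<Rightarrow> real \<Rightarrow> real^3 \<Rightarrow> (real^3) set" where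
  "circle m A e = {x. dist m x = A \<and> (x - m) \<bullet> e = 0}"

lemma circle_antipodal:
  assumes "A \<ge> 0"
  obtains v where "m + v \<in> circle m A e" "m - v \<in> circle m A e" "norm v = A"
proof -
  obtain w where w: "w \<noteq> 0" "orthogonal e w"
    using orthogonal_to_vector_exists[of e] by auto
  have "norm ((A / norm w) *\<^sub>R w) = A" using w assms by simp
  moreover have "((A / norm w) *\<^sub>R w) \<bullet> e = 0"
    using w by (simp add: orthogonal_def inner_commute)
  ultimately show ?thesis
    by (intro that[of "(A / norm w) *\<^sub>R w"]) (auto simp: circle_def dist_norm)
qed

text \<open>The parallelogram law for \<open>m - n\<close> and \<open>v\<close>. A ball containing a
  diameter of another ball has at least its radius, and a strictly larger one if the centres
  differ.\<close>

lemma antipodal_in_cball: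
  fixes m v n :: "'a::real_inner"
  assumes "m + v \<in> cball n B" "m - v \<in> cball n B"
  shows "(dist m n)\<^sup>2 + (norm v)\<^sup>2 \<le> B\<^sup>2"
proof -
  have "(norm (m - n + v))\<^sup>2 \<le> B\<^sup>2" "(norm (m - n - v))\<^sup>2 \<le> B\<^sup>2"
    using assms by (simp_all add: dist_norm norm_minus_commute algebra_simps power_mono)
  moreover have "(norm (m - n + v))\<^sup>2 + (norm (m - n - v))\<^sup>2 = 2 * (dist m n)\<^sup>2 + 2 * (norm v)\<^sup>2"
    by (simp add: dist_norm power2_norm_eq_inner inner_add_left inner_add_right inner_diff_left
        inner_diff_right inner_commute)
  ultimately show ?thesis by linarith
qed

lemma circle_subset_cball:
  assumes "circle m A e \<subseteq> cball n B" "A \<ge> 0"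
  shows "(dist m n)\<^sup>2 + A\<^sup>2 \<le> B\<^sup>2"
  using circle_antipodal[OF assms(2), of m e] antipodal_in_cball[of m _ n B] assms(1)
  by (metis subsetD)

text \<open>The ball shares centre and radius with the first circle, so the contact is along a great
  circle. This is what makes \<open>m\<close> and \<open>A\<close> recoverable from
  \<open>X\<close>.\<close>

definition two_circles :: "(real^3) set \<Rightarrow> real^3 \<Rightarrow> real \<Rightarrow> real^3 \<Rightarrow> real \<Rightarrow> real^3 \<Rightarrow> bool" where
  "two_circles X m A n B e \<longleftrightarrow> A > 0 \<and> B > 0 \<and> X \<subseteq> cball m A \<and> X \<inter> sphere m A = circle m A e
     \<and> X \<inter> {x. (x - m) \<bullet> e = 0} = circle m A e \<union> circle n B e \<and> circle m A e \<inter> circle n B e = {}"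

lemma circle_subset_imp_normal:
  assumes "circle m A e \<subseteq> circle m A e'" "A > 0" "v \<bullet> e = 0"
  shows "v \<bullet> e' = 0"
proof (cases "v = 0")
  case False
  then have "m + (A / norm v) *\<^sub>R v \<in> circle m A e"
    using assms by (auto simp: circle_def dist_norm)
  then have "m + (A / norm v) *\<^sub>R v \<in> circle m A e'" using assms by blast
  then show ?thesis using False assms by (simp add: circle_def)
qed simp

text \<open>Each enclosing ball contains a great circle of the other, so the balls agree. Their
  contact circles are then one set, which fixes the plane, and the second circle is the rest of the
  plane section. The normal is left out, being fixed only up to a factor.\<close>

lemma two_circles_unique:
  assumes X: "two_circles X m A n B e" and Y: "two_circles X m' A' n' B' e'"
  shows "m = m' \<and> A = A' \<and> n = n' \<and> B = B'"
proof -
  have "circle m A e \<subseteq> cball m' A'" "circle m' A' e' \<subseteq> cball m A"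
    using X Y unfolding two_circles_def by blast+
  then have *: "(dist m m')\<^sup>2 + A\<^sup>2 \<le> A'\<^sup>2" "(dist m m')\<^sup>2 + A'\<^sup>2 \<le> A\<^sup>2"
    using X Y circle_subset_cball[of m A e m' A'] circle_subset_cball[of m' A' e' m A]
    by (auto simp: two_circles_def dist_commute)
  then have "A\<^sup>2 = A'\<^sup>2" "(dist m m')\<^sup>2 \<le> 0"
    using zero_le_power2[of "dist m m'"] by linarith+
  then have mA: "m = m'" "A = A'" using X Y by (auto simp: two_circles_def power2_eq_iff)
  have c: "circle m A e = circle m A e'" using X Y mA by (simp add: two_circles_def)
  have e: "v \<bullet> e = 0 \<longleftrightarrow> v \<bullet> e' = 0" for v
    using circle_subset_imp_normal c X by (metis order_refl two_circles_def)
  then have "circle n B e = X \<inter> {x. (x - m) \<bullet> e = 0} - circle m A e"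
    "circle n' B' e' = X \<inter> {x. (x - m) \<bullet> e = 0} - circle m A e"
    using X Y mA c unfolding two_circles_def by auto
  then have "circle n B e = circle n' B' e'" by simp
  \<comment> \<open>The comparison of balls once more: equal circles have equal centres and
    radii.\<close>
  moreover have "circle n B e \<subseteq> cball n B" "circle n' B' e' \<subseteq> cball n' B'"
    by (auto simp: circle_def)
  ultimately have *: "(dist n n')\<^sup>2 + B\<^sup>2 \<le> B'\<^sup>2" "(dist n n')\<^sup>2 + B'\<^sup>2 \<le> B\<^sup>2"
    using X Y circle_subset_cball[of n B e n' B'] circle_subset_cball[of n' B' e' n B]
    by (auto simp: two_circles_def dist_commute)
  then have "B\<^sup>2 = B'\<^sup>2" "(dist n n')\<^sup>2 \<le> 0"
    using zero_le_power2[of "dist n n'"] by linarith+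
  then show ?thesis using X Y mA by (auto simp: two_circles_def power2_eq_iff)
qed

lemma two_circles_homothety:
  assumes X: "two_circles X m A n B e" and f: "homothety f"
  obtains c e' where "c > 0" "\<And>x y. dist (f x) (f y) = c * dist x y"
    "two_circles (f ` X) (f m) (c * A) (f n) (c * B) e'"
proof -
  obtain b c U where "c > 0" and U: "orthogonal_transformation U"
    and fe: "f = (\<lambda>x. b + U (c *\<^sub>R x))"
    using f unfolding homothety_def by blast
  have lin: "linear U" and n: "\<And>v. norm (U v) = norm v" and i: "\<And>v w. U v \<bullet> U w = v \<bullet> w"
    using U by (simp_all add: orthogonal_transformation_linear orthogonal_transformation_norm
        orthogonal_transformation_def)
  have d: "dist (f x) (f y) = c * dist x y" for x y
    using \<open>c > 0\<close> n by (simp add: fe dist_norm flip: scaleR_right_diff_distrib linear_diff[OF lin])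
  have ip: "(f x - f y) \<bullet> U e = 0 \<longleftrightarrow> (x - y) \<bullet> e = 0" for x y
    using \<open>c > 0\<close> i by (simp add: fe flip: scaleR_right_diff_distrib linear_diff[OF lin])
  have inj: "inj f" using d \<open>c > 0\<close>
    by (metis dist_eq_0_iff injI mult_eq_0_iff order_less_irrefl)
  have "surj U" using U by (rule orthogonal_transformation_surj)
  have "surj f"
  proof (rule surjI)
    fix y
    show "f (inverse c *\<^sub>R inv U (y - b)) = y"
      using \<open>c > 0\<close> \<open>surj U\<close> by (simp add: fe surj_f_inv_f)
  qed
  then have preimage: "f ` {x. P (f x)} = {y. P y}" for P by auto
  have C: "f ` circle z r e = circle (f z) (c * r) (U e)" for z r
    using preimage[of "\<lambda>y. dist (f z) y = c * r \<and> (y - f z) \<bullet> U e = 0"] \<open>c > 0\<close>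
    by (simp add: circle_def d ip)
  have "two_circles (f ` X) (f m) (c * A) (f n) (c * B) (U e)"
    unfolding two_circles_def
  proof (intro conjI)
    show "c * A > 0" "c * B > 0" using X \<open>c > 0\<close> by (auto simp: two_circles_def)
    show "f ` X \<subseteq> cball (f m) (c * A)"
      using X \<open>c > 0\<close> by (auto simp: two_circles_def d)
    have "f ` X \<inter> sphere (f m) (c * A) = f ` (X \<inter> sphere m A)" using \<open>c > 0\<close> by (auto simp: d)
    then show "f ` X \<inter> sphere (f m) (c * A) = circle (f m) (c * A) (U e)"
      using X by (simp add: two_circles_def C)
    have "f ` X \<inter> {x. (x - f m) \<bullet> U e = 0} = f ` (X \<inter> {x. (x - m) \<bullet> e = 0})" by (auto simp: ip)
    then show "f ` X \<inter> {x. (x - f m) \<bullet> U e = 0} = circle (f m) (c * A) (U e) \<union> circle (f n) (c * B) (U e)"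
      using X by (simp add: two_circles_def image_Un C)
    show "circle (f m) (c * A) (U e) \<inter> circle (f n) (c * B) (U e) = {}"
      using X inj unfolding C[symmetric] by (metis image_Int image_empty two_circles_def)
  qed
  then show thesis using that \<open>c > 0\<close> d by blast
qed

lemma shape_eq_two_circles:
  assumes "shape X = shape Y" "two_circles X m A n B e" "two_circles Y m' A' n' B' e'"
  obtains c where "c > 0" "A' = c * A" "B' = c * B" "dist m' n' = c * dist m n"
proof -
  obtain f where f: "homothety f" "Y = f ` X" using assms(1) unfolding shape_eq_iff by blast
  from two_circles_homothety[OF assms(2) f(1)] obtain c e'' where c: "c > 0"
    "\<And>x y. dist (f x) (f y) = c * dist x y"
    "two_circles Y (f m) (c * A) (f n) (c * B) e''" using f(2) by metis
  then show thesis using two_circles_unique[OF assms(3) c(3)] that[of c] by auto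
qed

section \<open>Two circles on an inverted torus\<close>

lemma square_add_square_gt_1:
  assumes "1 < (R :: real)"
  shows "h\<^sup>2 + R\<^sup>2 - 1 > 0"
proof -
  have "1 < R\<^sup>2" using assms by simp
  then show ?thesis using zero_le_power2[of h] by linarith
qed

text \<open>With \<rho> the distance from the axis, this is (\<rho> - R)^2 + z^2 = 1 rearranged as
  the level 2 R of (|y|^2 + R^2 - 1) / \<rho>. The surfaces \<open>revolved_circle R r\<close> are
  the levels r + (R^2 - 1) / r of the same function.\<close>

lemma mem_torus_iff:
  assumes "R > 1"
  shows "y \<in> torus R \<longleftrightarrow> (norm y)\<^sup>2 + R\<^sup>2 - 1 = 2 * R * sqrt ((y$1)\<^sup>2 + (y$2)\<^sup>2)"
proof
  assume "y \<in> torus R"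
  then obtain u v where y: "y = vector [(R + cos v) * cos u, (R + cos v) * sin u, sin v]"
    by (auto simp: torus_def)
  have "R + cos v \<ge> 0" using assms cos_ge_minus_one[of v] by linarith
  moreover have *: "(y$1)\<^sup>2 + (y$2)\<^sup>2 = (R + cos v)\<^sup>2"
    by (simp add: y power_mult_distrib flip: distrib_left)
  moreover have "(norm y)\<^sup>2 = (R + cos v)\<^sup>2 + (1 - (cos v)\<^sup>2)"
    unfolding norm_sq_3 * by (simp add: y sin_squared_eq)
  ultimately have "sqrt ((y$1)\<^sup>2 + (y$2)\<^sup>2) = R + cos v" "(norm y)\<^sup>2 = (R + cos v)\<^sup>2 + (1 - (cos v)\<^sup>2)"
    by simp_all
  then show "(norm y)\<^sup>2 + R\<^sup>2 - 1 = 2 * R * sqrt ((y$1)\<^sup>2 + (y$2)\<^sup>2)"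
    by (simp add: power2_sum algebra_simps power2_eq_square[of R])
next
  assume eq: "(norm y)\<^sup>2 + R\<^sup>2 - 1 = 2 * R * sqrt ((y$1)\<^sup>2 + (y$2)\<^sup>2)"
  define \<rho> where "\<rho> = sqrt ((y$1)\<^sup>2 + (y$2)\<^sup>2)"
  have \<rho>2: "\<rho>\<^sup>2 = (y$1)\<^sup>2 + (y$2)\<^sup>2" by (simp add: \<rho>_def)
  have "(norm y)\<^sup>2 + R\<^sup>2 - 1 > 0" by (rule square_add_square_gt_1[OF assms])
  then have "\<rho> > 0" using eq assms by (simp add: zero_less_mult_iff flip: \<rho>_def)
  have "\<rho>\<^sup>2 + (y$3)\<^sup>2 + R\<^sup>2 - 1 = 2 * R * \<rho>"
    using eq by (simp add: norm_sq_3 \<rho>2 flip: \<rho>_def)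
  then have "(\<rho> - R)\<^sup>2 + (y$3)\<^sup>2 = 1"
    by (simp add: power2_eq_square algebra_simps)
  then obtain v where v: "0 \<le> v" "v < 2 * pi" "\<rho> - R = cos v" "y$3 = sin v"
    using sincos_total_2pi by metis
  have "(y$1 / \<rho>)\<^sup>2 + (y$2 / \<rho>)\<^sup>2 = 1"
    using \<open>\<rho> > 0\<close> by (simp add: power_divide flip: \<rho>2 add_divide_distrib)
  then obtain u where u: "0 \<le> u" "u < 2 * pi" "y$1 / \<rho> = cos u" "y$2 / \<rho> = sin u"
    using sincos_total_2pi by metis
  have "y = vector [(R + cos v) * cos u, (R + cos v) * sin u, sin v]"
  proof -
    have "R + cos v = \<rho>" "\<rho> * cos u = y$1" "\<rho> * sin u = y$2"
      using \<open>\<rho> > 0\<close> by (simp_all flip: v(3) u(3,4))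
    then show ?thesis by (simp add: vec_eq_iff forall_3 v(4))
  qed
  with u v show "y \<in> torus R" unfolding torus_def by force
qed

text \<open>The assumption \<open>x \<noteq> p\<close> is due to the junk value \<open>inversion p p = p\<close>.\<close>

lemma power_of_point_inversion:
  assumes "x \<noteq> p" and k: "k = t\<^sup>2 - (norm (p - c))\<^sup>2" "k \<noteq> 0"
  shows "(norm (inversion p x - c))\<^sup>2 - t\<^sup>2
    = - (k / (norm (x - p))\<^sup>2) * ((norm (x - (p + (1 / k) *\<^sub>R (p - c))))\<^sup>2 - (t / k)\<^sup>2)"
proof -
  define w where "w = x - p"
  define a where "a = p - c"
  define N where "N = w \<bullet> w"
  have N: "N \<noteq> 0" using assms(1) by (simp add: N_def w_def)
  have aa: "a \<bullet> a = t\<^sup>2 - k" using k by (simp add: a_def power2_norm_eq_inner)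
  have "inversion p x - c = a + (1 / N) *\<^sub>R w"
    by (simp add: inversion_def a_def w_def N_def power2_norm_eq_inner)
  moreover have "(norm (a + (1 / N) *\<^sub>R w))\<^sup>2 = a \<bullet> a + 2 * (a \<bullet> w) / N + (1 / N)\<^sup>2 * N"
    unfolding power2_norm_eq_inner inner_add_left inner_add_right inner_scaleR_left
      inner_scaleR_right inner_commute[of w a] N_def[symmetric]
    by (simp add: power2_eq_square algebra_simps)
  moreover have "x - (p + (1 / k) *\<^sub>R (p - c)) = w - (1 / k) *\<^sub>R a"
    by (simp add: a_def w_def)
  moreover have "(norm (w - (1 / k) *\<^sub>R a))\<^sup>2 = N - 2 * (a \<bullet> w) / k + (1 / k)\<^sup>2 * (a \<bullet> a)"
    unfolding power2_norm_eq_inner inner_diff_left inner_diff_right inner_scaleR_left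
      inner_scaleR_right inner_commute[of w a] N_def[symmetric]
    by (simp add: power2_eq_square algebra_simps)
  moreover have "(norm (x - p))\<^sup>2 = N" by (simp add: w_def N_def power2_norm_eq_inner)
  ultimately have "(norm (inversion p x - c))\<^sup>2 = a \<bullet> a + 2 * (a \<bullet> w) / N + (1 / N)\<^sup>2 * N"
    "(norm (x - (p + (1 / k) *\<^sub>R (p - c))))\<^sup>2 = N - 2 * (a \<bullet> w) / k + (1 / k)\<^sup>2 * (a \<bullet> a)"
    "(norm (x - p))\<^sup>2 = N" by simp_all
  then show ?thesis
    unfolding aa using N \<open>k \<noteq> 0\<close> by (simp only:) (simp add: field_simps power2_eq_square)
qed

section \<open>Membership in the images of spheres, balls, planes and circles\<close>

lemma norm_eq_iff_square: "t \<ge> 0 \<Longrightarrow> norm v = t \<longleftrightarrow> (norm v)\<^sup>2 = t\<^sup>2"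
  by (simp add: power2_eq_iff_nonneg)

lemma norm_le_iff_square: "t \<ge> 0 \<Longrightarrow> norm v \<le> t \<longleftrightarrow> (norm v)\<^sup>2 \<le> t\<^sup>2"
  by simp

text \<open>\<open>- k\<close> is the power of \<open>p\<close> with respect to the sphere, so
  \<open>k \<noteq> 0\<close> keeps \<open>p\<close> off it and the image is again a sphere. The
  powers of a point and of its image with respect to the two spheres are proportional and vanish
  together.\<close>

lemma inversion_mem_sphere_iff:
  assumes k: "k = t\<^sup>2 - (norm (p - c))\<^sup>2" "k \<noteq> 0" and "t > 0"
  shows "x \<in> sphere (p + (1 / k) *\<^sub>R (p - c)) (t / \<bar>k\<bar>) \<longleftrightarrow> x \<noteq> p \<and> inversion p x \<in> sphere c t"
proof (cases "x = p")
  case True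
  have "(norm ((1 / k) *\<^sub>R (p - c)))\<^sup>2 \<noteq> (t / \<bar>k\<bar>)\<^sup>2"
    using k by (simp add: power_mult_distrib power_divide)
  then have "norm ((1 / k) *\<^sub>R (p - c)) \<noteq> t / \<bar>k\<bar>" by metis
  then show ?thesis using True by (simp add: dist_norm)
next
  case False
  have "x \<in> sphere (p + (1 / k) *\<^sub>R (p - c)) (t / \<bar>k\<bar>)
    \<longleftrightarrow> (norm (x - (p + (1 / k) *\<^sub>R (p - c))))\<^sup>2 = (t / \<bar>k\<bar>)\<^sup>2"
    using \<open>t > 0\<close> by (subst norm_eq_iff_square[symmetric]) (auto simp: dist_norm norm_minus_commute)
  also have "(t / \<bar>k\<bar>)\<^sup>2 = (t / k)\<^sup>2" by (simp add: power_divide)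
  also have "(norm (x - (p + (1 / k) *\<^sub>R (p - c))))\<^sup>2 = (t / k)\<^sup>2 \<longleftrightarrow> (norm (inversion p x - c))\<^sup>2 = t\<^sup>2"
    using power_of_point_inversion[OF False k] False k(2) by auto
  also have "\<dots> \<longleftrightarrow> inversion p x \<in> sphere c t"
    using \<open>t > 0\<close> by (subst norm_eq_iff_square[symmetric]) (auto simp: dist_norm norm_minus_commute)
  finally show ?thesis using False by simp
qed

text \<open>For \<open>k > 0\<close> the centre of inversion is inside the ball, which makes the
  factor between the two powers negative: the complement of the open ball goes to a closed
  ball.\<close>

lemma inversion_mem_cball_iff:
  assumes k: "k = t\<^sup>2 - (norm (p - c))\<^sup>2" "k > 0" and "t > 0" "x \<noteq> p"
  shows "x \<in> cball (p + (1 / k) *\<^sub>R (p - c)) (t / k) \<longleftrightarrow> inversion p x \<notin> ball c t"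
proof -
  have N: "(norm (x - p))\<^sup>2 > 0" and t: "t / k \<ge> 0" using assms(2-4) by simp_all
  have "x \<in> cball (p + (1 / k) *\<^sub>R (p - c)) (t / k)
    \<longleftrightarrow> (norm (x - (p + (1 / k) *\<^sub>R (p - c))))\<^sup>2 \<le> (t / k)\<^sup>2"
    by (subst norm_le_iff_square[symmetric, OF t]) (simp add: dist_norm norm_minus_commute)
  also have "\<dots> \<longleftrightarrow> (norm (inversion p x - c))\<^sup>2 - t\<^sup>2 \<ge> 0"
  proof -
    have "- P * Q \<ge> 0 \<longleftrightarrow> Q \<le> 0" if "P > 0" for P Q :: real
      using that by (simp add: mult_le_0_iff)
    moreover have "k / (norm (x - p))\<^sup>2 > 0" using N k(2) by simp
    ultimately show ?thesis
      unfolding power_of_point_inversion[OF \<open>x \<noteq> p\<close> k(1) less_imp_neq[OF k(2), symmetric]]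
      by (metis diff_le_0_iff_le)
  qed
  also have "\<dots> \<longleftrightarrow> inversion p x \<notin> ball c t"
    using assms by (simp add: dist_norm norm_minus_commute not_less)
  finally show ?thesis .
qed

text \<open>A plane through \<open>p\<close> is preserved, as inversion only rescales
  \<open>x - p\<close>. The free \<open>s\<close> lets the centre of an image circle serve as base
  point.\<close>

lemma inversion_mem_plane_iff:
  assumes "x \<noteq> p" "(p - c) \<bullet> e = 0"
  shows "(inversion p x - c) \<bullet> e = 0 \<longleftrightarrow> (x - (p + s *\<^sub>R (p - c))) \<bullet> e = 0"
proof -
  have "(inversion p x - c) \<bullet> e = ((x - p) \<bullet> e) / (norm (x - p))\<^sup>2"
    using assms(2) by (simp add: inversion_def inner_add_left inner_diff_left)
  moreover have "(x - (p + s *\<^sub>R (p - c))) \<bullet> e = (x - p) \<bullet> e"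
    using assms(2) by (simp add: inner_add_left inner_diff_left)
  ultimately show ?thesis using assms(1) by simp
qed

lemma inversion_mem_circle_iff:
  assumes "k = t\<^sup>2 - (norm (p - c))\<^sup>2" "k \<noteq> 0" "t > 0" "(p - c) \<bullet> e = 0"
  shows "x \<in> circle (p + (1 / k) *\<^sub>R (p - c)) (t / \<bar>k\<bar>) e \<longleftrightarrow> x \<noteq> p \<and> inversion p x \<in> circle c t e"
  using inversion_mem_sphere_iff[OF assms(1-3), of x] inversion_mem_plane_iff[OF _ assms(4), of x]
  by (auto simp: circle_def)

lemma inversion_image_iff:
  assumes "p \<notin> X"
  shows "x \<in> inversion p ` X \<longleftrightarrow> x \<noteq> p \<and> inversion p x \<in> X"
  using assms sphere_inversion_image_iff[of 1 x p X] sphere_inversion_eq_centre_iff[of 1 p p]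
  by (auto simp: inversion_eq_sphere_inversion)

text \<open>Moves the requirements of \<open>two_circles\<close> back to the surface before
  inversion. \<open>k > 0\<close> puts \<open>p\<close> into the ball that avoids \<open>X\<close>.
  The sign of \<open>k'\<close> stays open, as \<open>p\<close> lies inside the second circle in one
  application and outside it in the other.\<close>

lemma two_circles_inversion:
  assumes "p \<notin> X" "t > 0" "t' > 0" and k: "k = t\<^sup>2 - (norm (p - c))\<^sup>2" "k > 0"
    and k': "k' = t'\<^sup>2 - (norm (p - c'))\<^sup>2" "k' \<noteq> 0"
    and e: "(p - c) \<bullet> e = 0" "(p - c') \<bullet> e = 0"
    and X: "X \<inter> ball c t = {}" "X \<inter> sphere c t = circle c t e"
      "X \<inter> {x. (x - c) \<bullet> e = 0} = circle c t e \<union> circle c' t' e" "circle c t e \<inter> circle c' t' e = {}"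
  shows "two_circles (inversion p ` X) (p + (1 / k) *\<^sub>R (p - c)) (t / k)
    (p + (1 / k') *\<^sub>R (p - c')) (t' / \<bar>k'\<bar>) e"
proof -
  note k0 = less_imp_neq[OF k(2), symmetric]
  note Xi = inversion_image_iff[OF \<open>p \<notin> X\<close>]
  note C = inversion_mem_circle_iff[OF k(1) k0 \<open>t > 0\<close> e(1), unfolded abs_of_pos[OF k(2)]]
    and C' = inversion_mem_circle_iff[OF k' \<open>t' > 0\<close> e(2)]
  note S = inversion_mem_sphere_iff[OF k(1) k0 \<open>t > 0\<close>, unfolded abs_of_pos[OF k(2)]]
  show ?thesis
    unfolding two_circles_def
  proof (intro conjI)
    show "t / k > 0" "t' / \<bar>k'\<bar> > 0" using assms by simp_all
    show "inversion p ` X \<subseteq> cball (p + (1 / k) *\<^sub>R (p - c)) (t / k)"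
      using inversion_mem_cball_iff[OF k \<open>t > 0\<close>] Xi X(1) by blast
    show "inversion p ` X \<inter> sphere (p + (1 / k) *\<^sub>R (p - c)) (t / k) = circle (p + (1 / k) *\<^sub>R (p - c)) (t / k) e"
      unfolding set_eq_iff Int_iff Xi S C X(2)[symmetric] by blast
    show "inversion p ` X \<inter> {x. (x - (p + (1 / k) *\<^sub>R (p - c))) \<bullet> e = 0}
      = circle (p + (1 / k) *\<^sub>R (p - c)) (t / k) e \<union> circle (p + (1 / k') *\<^sub>R (p - c')) (t' / \<bar>k'\<bar>) e"
    proof (rule set_eqI)
      fix x
      show "x \<in> inversion p ` X \<inter> {x. (x - (p + (1 / k) *\<^sub>R (p - c))) \<bullet> e = 0} \<longleftrightarrow>
        x \<in> circle (p + (1 / k) *\<^sub>R (p - c)) (t / k) e \<union> circle (p + (1 / k') *\<^sub>R (p - c')) (t' / \<bar>k'\<bar>) e"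
        using inversion_mem_plane_iff[OF _ e(1), of x "1 / k"] X(3)
        unfolding Int_iff Un_iff Xi C C' set_eq_iff by blast
    qed
    show "circle (p + (1 / k) *\<^sub>R (p - c)) (t / k) e \<inter> circle (p + (1 / k') *\<^sub>R (p - c')) (t' / \<bar>k'\<bar>) e = {}"
      using X(4) C C' by blast
  qed
qed

section \<open>The torus in its symmetry planes\<close>

lemma inner_axis_1: "x \<bullet> axis i (1::real) = x$i"
  by (simp add: inner_axis)

lemma mem_sphere_iff_3:
  assumes "t \<ge> 0"
  shows "(x :: real^3) \<in> sphere c t \<longleftrightarrow> (x$1 - c$1)\<^sup>2 + (x$2 - c$2)\<^sup>2 + (x$3 - c$3)\<^sup>2 = t\<^sup>2"
  using norm_eq_iff_square[OF assms, of "x - c"] norm_sq_3[of "x - c"]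
  by (simp add: dist_norm norm_minus_commute)

lemma mem_circle_axis_iff:
  assumes "t \<ge> 0"
  shows "x \<in> circle c t (axis i 1) \<longleftrightarrow>
    (x$1 - c$1)\<^sup>2 + (x$2 - c$2)\<^sup>2 + (x$3 - c$3)\<^sup>2 = t\<^sup>2 \<and> x$i = c$i"
  using mem_sphere_iff_3[OF assms, of x c] by (auto simp: circle_def inner_axis_1)

lemma mem_ball_iff_3:
  assumes "t > 0"
  shows "(x :: real^3) \<in> ball c t \<longleftrightarrow> (x$1 - c$1)\<^sup>2 + (x$2 - c$2)\<^sup>2 + (x$3 - c$3)\<^sup>2 < t\<^sup>2"
proof -
  have "x \<in> ball c t \<longleftrightarrow> (norm (x - c))\<^sup>2 < t\<^sup>2"
    using assms by (simp add: dist_norm norm_minus_commute norm_lt_square power2_norm_eq_inner)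
  then show ?thesis by (simp add: norm_sq_3)
qed

abbreviation xpt :: "real \<Rightarrow> real^3" where
  "xpt r \<equiv> vector [r, 0, 0]"

lemma xpt_mem_torus_iff:
  assumes "R > 1" "r \<ge> 0"
  shows "xpt r \<in> torus R \<longleftrightarrow> r = R - 1 \<or> r = R + 1"
proof -
  have "xpt r \<in> torus R \<longleftrightarrow> r\<^sup>2 + R\<^sup>2 - 1 = 2 * R * r"
    using assms by (simp add: mem_torus_iff norm_sq_3)
  also have "\<dots> \<longleftrightarrow> (r - (R - 1)) * (r - (R + 1)) = 0"
  proof -
    have "(r - (R - 1)) * (r - (R + 1)) = r\<^sup>2 + R\<^sup>2 - 1 - 2 * R * r"
      by (simp add: power2_eq_square algebra_simps)
    then show ?thesis by linarith
  qed
  finally show ?thesis by simp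
qed

lemma mem_torus_iff_radius:
  assumes "1 < R"
  shows "x \<in> torus R \<longleftrightarrow> (\<exists>\<rho>\<ge>0. (x$1)\<^sup>2 + (x$2)\<^sup>2 = \<rho>\<^sup>2 \<and> (\<rho> - R)\<^sup>2 + (x$3)\<^sup>2 = 1)"
proof -
  define \<rho> where "\<rho> = sqrt ((x$1)\<^sup>2 + (x$2)\<^sup>2)"
  have "\<rho> \<ge> 0" and \<rho>2: "(x$1)\<^sup>2 + (x$2)\<^sup>2 = \<rho>\<^sup>2" by (simp_all add: \<rho>_def)
  have "x \<in> torus R \<longleftrightarrow> (\<rho> - R)\<^sup>2 + (x$3)\<^sup>2 = 1"
    unfolding mem_torus_iff[OF \<open>1 < R\<close>] norm_sq_3 \<rho>2
    using \<open>\<rho> \<ge> 0\<close> by (simp add: power2_diff) argo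
  then show ?thesis using \<open>\<rho> \<ge> 0\<close> \<rho>2 by (metis power2_eq_iff_nonneg)
qed

lemma unit_circle_bound:
  assumes "(\<rho> - R)\<^sup>2 + z\<^sup>2 = (1::real)"
  shows "R - 1 \<le> \<rho>" "\<rho> \<le> R + 1"
proof -
  have "(\<rho> - R)\<^sup>2 \<le> 1" using assms zero_le_power2[of z] by linarith
  then have "\<bar>\<rho> - R\<bar> \<le> 1" by (simp add: abs_square_le_1)
  then show "R - 1 \<le> \<rho>" "\<rho> \<le> R + 1" by linarith+
qed

text \<open>\<open>xpt r\<close> is in the hole, inside the ball of radius \<open>R - 1\<close>
  about the origin. That ball touches the torus along the inner equator, and the plane z = 0
  contains the outer equator as well.\<close>

lemma inverted_torus_outer:
  assumes "1 < R" "0 \<le> r" "r < R - 1"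
  shows "two_circles (inversion (xpt r) ` torus R)
    (xpt r + (1 / ((R - 1)\<^sup>2 - r\<^sup>2)) *\<^sub>R xpt r) ((R - 1) / ((R - 1)\<^sup>2 - r\<^sup>2))
    (xpt r + (1 / ((R + 1)\<^sup>2 - r\<^sup>2)) *\<^sub>R xpt r) ((R + 1) / ((R + 1)\<^sup>2 - r\<^sup>2)) (axis 3 1)"
proof -
  have k: "(R - 1)\<^sup>2 - r\<^sup>2 > 0" "(R + 1)\<^sup>2 - r\<^sup>2 > 0"
    using assms by (simp_all add: power_strict_mono)
  have n: "(norm (xpt r))\<^sup>2 = r\<^sup>2" by (simp add: norm_sq_3)
  note T = mem_torus_iff_radius[OF \<open>1 < R\<close>]
  have "two_circles (inversion (xpt r) ` torus R)
    (xpt r + (1 / ((R - 1)\<^sup>2 - r\<^sup>2)) *\<^sub>R (xpt r - 0)) ((R - 1) / ((R - 1)\<^sup>2 - r\<^sup>2))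
    (xpt r + (1 / ((R + 1)\<^sup>2 - r\<^sup>2)) *\<^sub>R (xpt r - 0)) ((R + 1) / \<bar>(R + 1)\<^sup>2 - r\<^sup>2\<bar>) (axis 3 1)"
  proof (rule two_circles_inversion)
    show "xpt r \<notin> torus R" using assms by (simp add: xpt_mem_torus_iff)
    have inner: "(R - 1)\<^sup>2 \<le> (x$1)\<^sup>2 + (x$2)\<^sup>2 + (x$3)\<^sup>2"
      "(x$1)\<^sup>2 + (x$2)\<^sup>2 + (x$3)\<^sup>2 = (R - 1)\<^sup>2 \<longrightarrow> x$3 = 0" if "x \<in> torus R" for x
    proof -
      obtain \<rho> where \<rho>: "\<rho> \<ge> 0" "(x$1)\<^sup>2 + (x$2)\<^sup>2 = \<rho>\<^sup>2" "(\<rho> - R)\<^sup>2 + (x$3)\<^sup>2 = 1"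
        using \<open>x \<in> torus R\<close> T by auto
      \<comment> \<open>On the torus |x|^2 is an affine function of \<rho>, minimal on the inner
        equator.\<close>
      have eq: "(x$1)\<^sup>2 + (x$2)\<^sup>2 + (x$3)\<^sup>2 - (R - 1)\<^sup>2 = 2 * R * (\<rho> - (R - 1))"
        unfolding \<rho>(2) using \<rho>(3) by (simp add: power2_eq_square algebra_simps)
      moreover have "2 * R * (\<rho> - (R - 1)) \<ge> 0" using unit_circle_bound[OF \<rho>(3)] assms by simp
      ultimately show "(R - 1)\<^sup>2 \<le> (x$1)\<^sup>2 + (x$2)\<^sup>2 + (x$3)\<^sup>2" by linarith
      show "(x$1)\<^sup>2 + (x$2)\<^sup>2 + (x$3)\<^sup>2 = (R - 1)\<^sup>2 \<longrightarrow> x$3 = 0"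
        using eq \<rho>(3) assms by auto
    qed
    have plane: "x \<in> torus R \<longleftrightarrow> (x$1)\<^sup>2 + (x$2)\<^sup>2 = (R - 1)\<^sup>2 \<or> (x$1)\<^sup>2 + (x$2)\<^sup>2 = (R + 1)\<^sup>2"
      if "x$3 = 0" for x
    proof -
      have *: "(\<rho> - R)\<^sup>2 + 0\<^sup>2 = 1 \<longleftrightarrow> \<rho> = R - 1 \<or> \<rho> = R + 1" for \<rho>
        by (auto simp: power2_eq_1_iff)
      have "R - 1 \<ge> 0" "R + 1 \<ge> 0" using assms by simp_all
      then show ?thesis unfolding T that * by metis
    qed
    have "x \<notin> ball 0 (R - 1)" if "x \<in> torus R" for x
      using inner(1)[OF that] assms mem_ball_iff_3[of "R - 1" x "0"] by simp
    then show "torus R \<inter> ball 0 (R - 1) = {}" by blast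
    show "torus R \<inter> sphere 0 (R - 1) = circle 0 (R - 1) (axis 3 1)"
      using inner(2) plane assms
      by (auto simp: mem_sphere_iff_3 mem_circle_axis_iff simp del: mem_sphere mem_sphere_0)
    show "torus R \<inter> {x. (x - 0) \<bullet> axis 3 1 = 0} = circle 0 (R - 1) (axis 3 1) \<union> circle 0 (R + 1) (axis 3 1)"
      using plane assms by (auto simp: mem_circle_axis_iff inner_axis_1)
    show "circle 0 (R - 1) (axis 3 1) \<inter> circle 0 (R + 1) (axis 3 1) = {}"
      using assms by (auto simp: circle_def)
  qed (use assms k n in \<open>auto simp: inner_axis_1\<close>)
  then show ?thesis using k by simp
qed

text \<open>Now \<open>xpt r\<close> is inside the tube, in the unit ball about
  \<open>xpt R\<close>. That ball touches the torus along a meridian circle, and the plane y = 0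
  contains the opposite meridian, to which \<open>xpt r\<close> is exterior; hence the reversed sign
  in the second radius.\<close>

lemma inverted_torus_inner:
  assumes "1 < R" "R - 1 < r" "r < R + 1"
  shows "two_circles (inversion (xpt r) ` torus R)
    (xpt r + (1 / (1 - (r - R)\<^sup>2)) *\<^sub>R xpt (r - R)) (1 / (1 - (r - R)\<^sup>2))
    (xpt r + (1 / (1 - (r + R)\<^sup>2)) *\<^sub>R xpt (r + R)) (1 / ((r + R)\<^sup>2 - 1)) (axis 2 1)"
proof -
  have k: "1 - (r - R)\<^sup>2 > 0" "1 - (r + R)\<^sup>2 < 0"
    using assms by (simp_all add: abs_square_less_1)
  have d: "xpt r - xpt c = xpt (r - c)" for c
    by (simp add: vec_eq_iff forall_3)
  have n: "(norm (xpt s))\<^sup>2 = s\<^sup>2" for s by (simp add: norm_sq_3)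
  have "two_circles (inversion (xpt r) ` torus R)
    (xpt r + (1 / (1 - (r - R)\<^sup>2)) *\<^sub>R (xpt r - xpt R)) (1 / (1 - (r - R)\<^sup>2))
    (xpt r + (1 / (1 - (r + R)\<^sup>2)) *\<^sub>R (xpt r - xpt (- R))) (1 / \<bar>1 - (r + R)\<^sup>2\<bar>) (axis 2 1)"
  proof (rule two_circles_inversion)
    show "xpt r \<notin> torus R" using assms by (simp add: xpt_mem_torus_iff)
    have inner: "1 \<le> (x$1 - R)\<^sup>2 + (x$2)\<^sup>2 + (x$3)\<^sup>2"
      "(x$1 - R)\<^sup>2 + (x$2)\<^sup>2 + (x$3)\<^sup>2 = 1 \<longrightarrow> x$2 = 0" if "x \<in> torus R" for x
    proof -
      define \<rho> where "\<rho> = sqrt ((x$1)\<^sup>2 + (x$2)\<^sup>2)"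
      \<comment> \<open>The excess over 1 vanishes only for \<open>\<rho> = x$1\<close>, that is, in
        the half-plane y = 0, x \<ge> 0.\<close>
      have eq: "(x$1 - R)\<^sup>2 + (x$2)\<^sup>2 + (x$3)\<^sup>2 - 1 = 2 * R * (\<rho> - x$1)"
        using that unfolding mem_torus_iff[OF \<open>1 < R\<close>] norm_sq_3 \<rho>_def[symmetric]
        by (simp add: power2_diff algebra_simps)
      have "x$1 \<le> \<rho>" unfolding \<rho>_def by (rule real_le_rsqrt) simp
      then have "2 * R * (\<rho> - x$1) \<ge> 0" using assms by simp
      then show "1 \<le> (x$1 - R)\<^sup>2 + (x$2)\<^sup>2 + (x$3)\<^sup>2" using eq by linarith
      have "x$2 = 0" if "\<rho> = x$1"
      proof -
        have "\<rho>\<^sup>2 = (x$1)\<^sup>2 + (x$2)\<^sup>2" by (simp add: \<rho>_def)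
        then show ?thesis using that by simp
      qed
      then show "(x$1 - R)\<^sup>2 + (x$2)\<^sup>2 + (x$3)\<^sup>2 = 1 \<longrightarrow> x$2 = 0"
        using eq assms by auto
    qed
    have plane: "x \<in> torus R \<longleftrightarrow> (x$1 - R)\<^sup>2 + (x$3)\<^sup>2 = 1 \<or> (x$1 + R)\<^sup>2 + (x$3)\<^sup>2 = 1"
      if "x$2 = 0" for x
    proof -
      have "x \<in> torus R \<longleftrightarrow> (x$1)\<^sup>2 + (x$3)\<^sup>2 + R\<^sup>2 - 1 = 2 * R * \<bar>x$1\<bar>"
        unfolding mem_torus_iff[OF \<open>1 < R\<close>] norm_sq_3 by (simp add: that)
      also have "\<dots> \<longleftrightarrow> (x$1)\<^sup>2 + (x$3)\<^sup>2 + R\<^sup>2 - 1 = 2 * R * x$1 \<or> (x$1)\<^sup>2 + (x$3)\<^sup>2 + R\<^sup>2 - 1 = 2 * R * (- x$1)"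
      proof -
        have "(x$1)\<^sup>2 + (x$3)\<^sup>2 + R\<^sup>2 - 1 > 0"
          using square_add_square_gt_1[OF assms(1), of "x$1"] zero_le_power2[of "x$3"] by linarith
        moreover have "2 * R * x$1 \<ge> 0 \<longleftrightarrow> x$1 \<ge> 0" using assms by (simp add: zero_le_mult_iff)
        ultimately show ?thesis by (cases "x$1 \<ge> 0") auto
      qed
      also have "\<dots> \<longleftrightarrow> (x$1 - R)\<^sup>2 + (x$3)\<^sup>2 = 1 \<or> (x$1 + R)\<^sup>2 + (x$3)\<^sup>2 = 1"
        by (simp add: power2_diff power2_sum algebra_simps)
      finally show ?thesis .
    qed
    have "x \<notin> ball (xpt R) 1" if "x \<in> torus R" for x
      using inner(1)[OF that] assms mem_ball_iff_3[of "1" x "xpt R"] by simp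
    then show "torus R \<inter> ball (xpt R) 1 = {}" by blast
    show "torus R \<inter> sphere (xpt R) 1 = circle (xpt R) 1 (axis 2 1)"
      using inner(2) plane assms
      by (auto simp: mem_sphere_iff_3 mem_circle_axis_iff simp del: mem_sphere mem_sphere_0)
    show "torus R \<inter> {x. (x - xpt R) \<bullet> axis 2 1 = 0} = circle (xpt R) 1 (axis 2 1) \<union> circle (xpt (- R)) 1 (axis 2 1)"
      using plane assms by (auto simp: mem_circle_axis_iff inner_axis_1)
    have False if "(y - R)\<^sup>2 + z\<^sup>2 = 1" "(y + R)\<^sup>2 + z\<^sup>2 = 1" for y z
    proof -
      have "(y + R)\<^sup>2 - (y - R)\<^sup>2 = 4 * R * y"
        by (simp add: power2_eq_square algebra_simps)
      then have "4 * R * y = 0" using that by linarith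
      then show False
        using that \<open>1 < R\<close> square_add_square_gt_1[OF \<open>1 < R\<close>, of z] by simp
    qed
    then show "circle (xpt R) 1 (axis 2 1) \<inter> circle (xpt (- R)) 1 (axis 2 1) = {}"
      by (auto simp: mem_circle_axis_iff)
    show "1 - (r + R)\<^sup>2 \<noteq> 0" using k by linarith
  qed (use assms k in \<open>auto simp: inner_axis_1 d n\<close>)
  then show ?thesis using k by (simp add: d)
qed

section \<open>Conformal symmetries of the torus\<close>

lemma image_eq_if_preserved:
  assumes "surj f" "\<And>x. f x \<in> X \<longleftrightarrow> x \<in> X"
  shows "f ` X = X"
proof
  show "f ` X \<subseteq> X" using assms(2) by blast
  show "X \<subseteq> f ` X"
  proof
    fix x assume "x \<in> X"
    then show "x \<in> f ` X" using assms surjD[OF assms(1), of x] by blast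
  qed
qed

lemma sphere_inversion_preserves:
  assumes "k \<noteq> 0" "q \<notin> X" "\<And>x. x \<noteq> q \<Longrightarrow> sphere_inversion q k x \<in> X \<longleftrightarrow> x \<in> X"
  shows "sphere_inversion q k ` X = X"
proof -
  have "sphere_inversion q k q = q" by (simp add: sphere_inversion_def)
  then have "x \<in> sphere_inversion q k ` X \<longleftrightarrow> x \<in> X" for x
    using assms by (cases "x = q") (simp_all add: sphere_inversion_image_iff)
  then show ?thesis by blast
qed

text \<open>Clockwise rotation by the angle with cosine \<open>a\<close> and sine \<open>b\<close>.
  With this pair as parameter, a point is turned into the xz-plane by its own normalized
  coordinates, without choosing an angle.\<close>

definition z_rotation :: "real \<Rightarrow> real \<Rightarrow> real^3 \<Rightarrow> real^3" where
  "z_rotation a b x = vector [a * x$1 + b * x$2, a * x$2 - b * x$1, x$3]"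

lemma z_rotation_radius:
  assumes "a\<^sup>2 + b\<^sup>2 = 1"
  shows "(z_rotation a b x $ 1)\<^sup>2 + (z_rotation a b x $ 2)\<^sup>2 = (x$1)\<^sup>2 + (x$2)\<^sup>2"
proof -
  have "(z_rotation a b x $ 1)\<^sup>2 + (z_rotation a b x $ 2)\<^sup>2 = (a\<^sup>2 + b\<^sup>2) * ((x$1)\<^sup>2 + (x$2)\<^sup>2)"
    by (simp add: z_rotation_def power2_eq_square algebra_simps)
  then show ?thesis by (simp add: assms)
qed

lemma z_rotation_norm:
  assumes "a\<^sup>2 + b\<^sup>2 = 1"
  shows "norm (z_rotation a b x) = norm x"
proof -
  have "(norm (z_rotation a b x))\<^sup>2 = (norm x)\<^sup>2"
    unfolding norm_sq_3 z_rotation_radius[OF assms] by (simp add: z_rotation_def)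
  then show ?thesis by simp
qed

lemma orthogonal_z_rotation:
  assumes "a\<^sup>2 + b\<^sup>2 = 1"
  shows "orthogonal_transformation (z_rotation a b)"
proof -
  have "linear (z_rotation a b)"
    by (intro linearI) (simp_all add: z_rotation_def vec_eq_iff forall_3 algebra_simps)
  then show ?thesis
    unfolding orthogonal_transformation using z_rotation_norm[OF assms] by blast
qed

lemma z_rotation_torus:
  assumes "1 < R" "a\<^sup>2 + b\<^sup>2 = 1"
  shows "z_rotation a b ` torus R = torus R"
proof (rule image_eq_if_preserved)
  show "surj (z_rotation a b)"
    using orthogonal_z_rotation[OF assms(2)] by (rule orthogonal_transformation_surj)
  show "z_rotation a b x \<in> torus R \<longleftrightarrow> x \<in> torus R" for x
    unfolding mem_torus_iff[OF assms(1)] z_rotation_radius[OF assms(2)] z_rotation_norm[OF assms(2)] ..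
qed

abbreviation zpt :: "real \<Rightarrow> real^3" where
  "zpt h \<equiv> vector [0, 0, h]"

lemma zpt_not_mem_torus: "1 < R \<Longrightarrow> zpt h \<notin> torus R"
proof -
  assume "1 < R"
  then show ?thesis using square_add_square_gt_1[of R h] by (simp add: mem_torus_iff norm_sq_3)
qed

text \<open>The spheres centred on the axis and orthogonal to every torus of the pencil
  \<open>|x|\<^sup>2 + R\<^sup>2 - 1 = w \<rho>\<close> are those through the core circle \<open>\<rho> = sqrt (R\<^sup>2 - 1)\<close>, \<open>z = 0\<close>.\<close>

lemma axial_inversion_torus:
  assumes "1 < R"
  shows "sphere_inversion (zpt h) (h\<^sup>2 + R\<^sup>2 - 1) ` torus R = torus R"
proof (rule sphere_inversion_preserves)
  define k where "k = h\<^sup>2 + R\<^sup>2 - 1"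
  have k: "k > 0" unfolding k_def by (rule square_add_square_gt_1[OF assms])
  then show "h\<^sup>2 + R\<^sup>2 - 1 \<noteq> 0" by (simp add: k_def)
  show "zpt h \<notin> torus R" by (rule zpt_not_mem_torus[OF assms])
  fix x assume "x \<noteq> zpt h"
  define M where "M = (norm (x - zpt h))\<^sup>2"
  define l where "l = k / M"
  have M: "M > 0" using \<open>x \<noteq> zpt h\<close> by (simp add: M_def)
  then have l: "l > 0" "l * M = k" using k by (simp_all add: l_def)
  define y where "y = sphere_inversion (zpt h) (h\<^sup>2 + R\<^sup>2 - 1) x"
  have "y = zpt h + l *\<^sub>R (x - zpt h)"
    by (simp add: y_def sphere_inversion_def l_def k_def M_def)
  then have y: "y$1 = l * x$1" "y$2 = l * x$2" "y$3 = h + l * (x$3 - h)" by simp_all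
  have M': "M = (x$1)\<^sup>2 + (x$2)\<^sup>2 + (x$3 - h)\<^sup>2" by (simp add: M_def norm_sq_3)
  have ny: "(norm y)\<^sup>2 = l * (l * M) + h\<^sup>2 + 2 * h * l * (x$3 - h)"
    unfolding norm_sq_3 y M' by (simp add: power2_eq_square algebra_simps)
  have nx: "(norm x)\<^sup>2 = M + 2 * h * x$3 - h\<^sup>2"
    unfolding norm_sq_3 M' by (simp add: power2_eq_square algebra_simps)
  \<comment> \<open>Both sides of the torus equation are multiplied by the same factor
    \<open>l\<close>, so every level of the pencil is preserved.\<close>
  have "(norm y)\<^sup>2 + R\<^sup>2 - 1 = l * ((norm x)\<^sup>2 + R\<^sup>2 - 1)"
    unfolding nx ny l(2) using l(2) by (simp add: k_def power2_eq_square algebra_simps)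
  moreover have "sqrt ((y$1)\<^sup>2 + (y$2)\<^sup>2) = l * sqrt ((x$1)\<^sup>2 + (x$2)\<^sup>2)"
    using l by (simp add: y power_mult_distrib real_sqrt_mult flip: distrib_left)
  ultimately show "sphere_inversion (zpt h) (h\<^sup>2 + R\<^sup>2 - 1) x \<in> torus R \<longleftrightarrow> x \<in> torus R"
    using l unfolding mem_torus_iff[OF assms] y_def[symmetric] by (simp add: mult.assoc)
qed

lemma shape_inverted_torus_axial_inversion:
  assumes "1 < R" "p \<notin> torus R" "p \<noteq> zpt h"
  shows "shape (inversion (sphere_inversion (zpt h) (h\<^sup>2 + R\<^sup>2 - 1) p) ` torus R)
    = shape (inversion p ` torus R)"
proof -
  from shape_inversion_sphere_inversion[OF square_add_square_gt_1[OF assms(1), of h] assms(3,2) zpt_not_mem_torus[OF assms(1)]]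
  show ?thesis unfolding axial_inversion_torus[OF assms(1)] .
qed

lemma shape_inverted_torus_axis:
  assumes "1 < R"
  shows "shape (inversion (zpt z) ` torus R) = shape (inversion (xpt 0) ` torus R)"
proof (cases "z = 0")
  case False
  define s where "s = R\<^sup>2 - 1"
  \<comment> \<open>\<open>h\<close> solves (z - h) (0 - h) = h^2 + s, the condition for the
    inversion to send \<open>zpt z\<close> to the origin.\<close>
  define h where "h = - s / z"
  have "s > 0" using assms by (simp add: s_def)
  have zh: "z - h = (z\<^sup>2 + s) / z" "h\<^sup>2 + R\<^sup>2 - 1 = s * (z\<^sup>2 + s) / z\<^sup>2"
    using False by (simp_all add: h_def field_simps power2_eq_square) (simp add: s_def power2_eq_square algebra_simps)
  have "z\<^sup>2 + s > 0" using \<open>s > 0\<close> by (simp add: add_nonneg_pos)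
  then have "z - h \<noteq> 0" using False unfolding zh by simp
  then have "zpt z \<noteq> zpt h" by (metis right_minus_eq vector_3(3))
  moreover have "sphere_inversion (zpt h) (h\<^sup>2 + R\<^sup>2 - 1) (zpt z) = xpt 0"
  proof -
    have "(norm (zpt z - zpt h))\<^sup>2 = ((z\<^sup>2 + s) / z)\<^sup>2" by (simp add: norm_sq_3 flip: zh)
    then have "sphere_inversion (zpt h) (h\<^sup>2 + R\<^sup>2 - 1) (zpt z)
      = zpt h + (s * (z\<^sup>2 + s) / z\<^sup>2 / ((z\<^sup>2 + s) / z)\<^sup>2) *\<^sub>R (zpt z - zpt h)"
      by (simp add: sphere_inversion_def zh)
    also have "s * (z\<^sup>2 + s) / z\<^sup>2 / ((z\<^sup>2 + s) / z)\<^sup>2 = s / (z\<^sup>2 + s)"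
      using False \<open>z\<^sup>2 + s > 0\<close> by (simp add: power_divide) (simp add: power2_eq_square)
    finally show ?thesis
      using False \<open>z\<^sup>2 + s > 0\<close> by (simp add: vec_eq_iff forall_3 zh) (simp add: h_def)
  qed
  ultimately show ?thesis
    using shape_inverted_torus_axial_inversion[OF assms zpt_not_mem_torus[OF assms], of z h] by simp
qed simp

lemma torus_parameter_iff:
  assumes "r \<noteq> 0"
  shows "r + (R\<^sup>2 - 1) / r = 2 * R \<longleftrightarrow> r = R - 1 \<or> r = R + (1::real)"
proof -
  have "r + (R\<^sup>2 - 1) / r - 2 * R = (r - (R - 1)) * (r - (R + 1)) / r"
    using assms by (simp add: field_simps power2_eq_square)
  then have "r + (R\<^sup>2 - 1) / r = 2 * R \<longleftrightarrow> (r - (R - 1)) * (r - (R + 1)) / r = 0" by linarith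
  then show ?thesis using assms by simp
qed

text \<open>The last hypothesis puts \<open>p\<close> on the level of \<open>xpt r\<close>. After a
  rotation into the xz-half-plane, an axial inversion does the rest: it keeps the level circle and
  every line through its centre, so it exchanges the two points in which such a line meets the
  circle.\<close>

lemma shape_inverted_torus_level:
  assumes "1 < R" "0 < r" "r \<noteq> R - 1" "r \<noteq> R + 1"
    and p: "(norm p)\<^sup>2 + R\<^sup>2 - 1 = (r + (R\<^sup>2 - 1) / r) * sqrt ((p$1)\<^sup>2 + (p$2)\<^sup>2)"
  shows "shape (inversion p ` torus R) = shape (inversion (xpt r) ` torus R)"
proof -
  define s where "s = R\<^sup>2 - 1"
  define \<rho> where "\<rho> = sqrt ((p$1)\<^sup>2 + (p$2)\<^sup>2)"
  define z where "z = p$3"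
  have s: "s > 0" using assms by (simp add: s_def)
  have "\<rho> \<ge> 0" and \<rho>2: "\<rho>\<^sup>2 = (p$1)\<^sup>2 + (p$2)\<^sup>2" by (simp_all add: \<rho>_def)
  have lev: "\<rho>\<^sup>2 + z\<^sup>2 + s = (r + s / r) * \<rho>"
    using p by (simp add: norm_sq_3 z_def s_def \<rho>2 flip: \<rho>_def)
  have "\<rho> \<noteq> 0"
  proof
    assume "\<rho> = 0"
    then have "z\<^sup>2 + s = 0" using lev by simp
    then show False using s zero_le_power2[of z] by linarith
  qed
  then have \<rho>: "\<rho> > 0" using \<open>\<rho> \<ge> 0\<close> by simp
  have "p \<notin> torus R"
  proof
    assume "p \<in> torus R"
    then have "(r + s / r) * \<rho> = 2 * R * \<rho>"
      using p unfolding mem_torus_iff[OF \<open>1 < R\<close>] s_def \<rho>_def by linarith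
    then show False using assms \<rho> by (simp add: s_def torus_parameter_iff)
  qed
  define U where "U = z_rotation (p$1 / \<rho>) (p$2 / \<rho>)"
  define p' :: "real^3" where "p' = vector [\<rho>, 0, z]"
  have ab: "(p$1 / \<rho>)\<^sup>2 + (p$2 / \<rho>)\<^sup>2 = 1"
    using \<rho> by (simp add: power_divide flip: \<rho>2 add_divide_distrib)
  have "p$1 / \<rho> * p$1 + p$2 / \<rho> * p$2 = \<rho>"
    using \<rho> by (simp add: field_simps flip: power2_eq_square) (simp add: \<rho>2)
  then have "U p = p'"
    by (simp add: U_def z_rotation_def p'_def z_def vec_eq_iff forall_3)
  then have *: "shape (inversion p' ` torus R) = shape (inversion p ` torus R)"
    using shape_inversion_orthogonal[OF orthogonal_z_rotation[OF ab], of p "torus R"]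
    unfolding z_rotation_torus[OF \<open>1 < R\<close> ab] by (simp add: U_def)
  show ?thesis
  proof (cases "\<rho> = r")
    case True
    then have "z = 0" using lev \<open>0 < r\<close> by (simp add: field_simps power2_eq_square)
    then show ?thesis using * True by (simp add: p'_def)
  next
    case False
    \<comment> \<open>The line through \<open>(\<rho>, z)\<close> and \<open>(r, 0)\<close> meets the axis at height \<open>h\<close>.\<close>
    define h where "h = z * r / (r - \<rho>)"
    have "p'$1 \<noteq> zpt h $ 1" using \<rho> by (simp add: p'_def)
    then have "p' \<noteq> zpt h" by metis
    have "p' \<notin> torus R"
      using \<open>p \<notin> torus R\<close> unfolding \<open>U p = p'\<close>[symmetric] U_def
      by (simp add: mem_torus_iff[OF \<open>1 < R\<close>] z_rotation_norm[OF ab] z_rotation_radius[OF ab])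
    have zh: "z - h = - z * \<rho> / (r - \<rho>)" using False by (simp add: h_def field_simps)
    have rz: "r * z\<^sup>2 = (r - \<rho>) * (r * \<rho> - s)"
      using lev \<open>0 < r\<close> by (simp add: field_simps power2_eq_square)
    \<comment> \<open>Equivalently, the inversion multiplies \<open>p' - zpt h\<close> by
      \<open>r / \<rho>\<close>, the factor that takes the abscissa \<rho> to
      \<open>r\<close>.\<close>
    have "(h\<^sup>2 + s) * \<rho> = r * (\<rho>\<^sup>2 + (z - h)\<^sup>2)"
    proof -
      have "(h\<^sup>2 + s) * \<rho> * (r - \<rho>)\<^sup>2 - r * (\<rho>\<^sup>2 + (z - h)\<^sup>2) * (r - \<rho>)\<^sup>2
        = (z\<^sup>2 * r\<^sup>2 + s * (r - \<rho>)\<^sup>2) * \<rho> - r * (\<rho>\<^sup>2 * (r - \<rho>)\<^sup>2 + z\<^sup>2 * \<rho>\<^sup>2)"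
        unfolding zh using False by (simp add: h_def power_divide distrib_right power_mult_distrib)
      also have "\<dots> = \<rho> * (r - \<rho>) * (r * z\<^sup>2 - (r - \<rho>) * (r * \<rho> - s))"
        by (simp add: power2_eq_square algebra_simps)
      also have "\<dots> = 0" by (simp add: rz)
      finally have "(h\<^sup>2 + s) * \<rho> * (r - \<rho>)\<^sup>2 = r * (\<rho>\<^sup>2 + (z - h)\<^sup>2) * (r - \<rho>)\<^sup>2" by simp
      then show ?thesis using False by simp
    qed
    moreover have "\<rho>\<^sup>2 + (z - h)\<^sup>2 > 0" using \<rho> by (simp add: add_pos_nonneg)
    ultimately have l: "(h\<^sup>2 + s) / (\<rho>\<^sup>2 + (z - h)\<^sup>2) = r / \<rho>" using \<rho> by (simp add: field_simps)
    have "sphere_inversion (zpt h) (h\<^sup>2 + R\<^sup>2 - 1) p' = zpt h + (r / \<rho>) *\<^sub>R (p' - zpt h)"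
      unfolding l[symmetric] by (simp add: sphere_inversion_def norm_sq_3 p'_def s_def)
    also have "\<dots> = xpt r"
      using \<rho> by (simp add: vec_eq_iff forall_3 p'_def zh) (simp add: h_def)
    finally show ?thesis
      using shape_inverted_torus_axial_inversion[OF \<open>1 < R\<close> \<open>p' \<notin> torus R\<close> \<open>p' \<noteq> zpt h\<close>] * by simp
  qed
qed

section \<open>The common shape along a revolved circle\<close>

lemma profile_circle_iff:
  assumes "0 < r"
  shows "(x, z) \<in> profile_circle R (ereal r) \<longleftrightarrow> (x - r) * (x - (R\<^sup>2 - 1) / r) + z\<^sup>2 = 0"
proof -
  define c where "c = (R\<^sup>2 - 1) / r"
  have "(x, z) \<in> profile_circle R (ereal r)
    \<longleftrightarrow> sqrt (((r + c) / 2 - x)\<^sup>2 + z\<^sup>2) = sqrt (((r - c) / 2)\<^sup>2)"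
    using assms
    by (simp add: profile_circle_def Let_def midpoint_def dist_Pair_Pair dist_real_def
        flip: c_def zero_ereal_def)
  also have "\<dots> \<longleftrightarrow> ((r + c) / 2 - x)\<^sup>2 + z\<^sup>2 = ((r - c) / 2)\<^sup>2" by (rule real_sqrt_eq_iff)
  \<comment> \<open>Thales: the points of the circle see its diameter under a right angle. The
    single point \<open>r = c\<close> is covered.\<close>
  also have "\<dots> \<longleftrightarrow> (x - r) * (x - c) + z\<^sup>2 = 0"
    by (simp add: field_simps power2_eq_square) argo
  finally show ?thesis unfolding c_def .
qed

lemma revolved_circle_level:
  assumes "1 < R" "0 < r" "p \<in> revolved_circle R (ereal r)"
  shows "(norm p)\<^sup>2 + R\<^sup>2 - 1 = (r + (R\<^sup>2 - 1) / r) * sqrt ((p$1)\<^sup>2 + (p$2)\<^sup>2)"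
proof -
  define c where "c = (R\<^sup>2 - 1) / r"
  obtain x t z where p: "p = vector [x * cos t, x * sin t, z]" and "(x, z) \<in> profile_circle R (ereal r)"
    using assms(3) by (auto simp: revolved_circle_def)
  then have x: "(x - r) * (x - c) + z\<^sup>2 = 0" using profile_circle_iff[OF \<open>0 < r\<close>] by (simp add: c_def)
  have "c > 0" using assms by (simp add: c_def)
  \<comment> \<open>Both ends of the diameter have positive abscissa, so the circle stays in the
    half-plane and \<open>x\<close> is the distance from the axis.\<close>
  have "(x - r) * (x - c) > 0" if "x < 0"
    using that \<open>c > 0\<close> \<open>r > 0\<close> by (intro mult_neg_neg) linarith+
  then have "x \<ge> 0" using x zero_le_power2[of z] by fastforce
  have p12: "(p$1)\<^sup>2 + (p$2)\<^sup>2 = x\<^sup>2" by (simp add: p power_mult_distrib flip: distrib_left)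
  have "R\<^sup>2 - 1 = r * c" using assms by (simp add: c_def)
  then show ?thesis
    using x \<open>x \<ge> 0\<close> unfolding norm_sq_3 p12 c_def[symmetric]
    by (simp add: p power2_eq_square algebra_simps)
qed

text \<open>The witness \<open>q\<close> gives uniqueness in the description: over an empty set
  every \<open>s\<close> would qualify.\<close>

lemma inverted_torus_shape_eqI:
  assumes "q \<in> revolved_circle R r"
    and "\<And>p. p \<in> revolved_circle R r \<Longrightarrow> shape (inversion p ` torus R) = s"
  shows "inverted_torus_shape R r = s"
  unfolding inverted_torus_shape_def
proof (rule the_equality)
  show "\<forall>p\<in>revolved_circle R r. shape (inversion p ` torus R) = s" using assms(2) by blast
  show "t = s" if "\<forall>p\<in>revolved_circle R r. shape (inversion p ` torus R) = t" for t
    using bspec[OF that assms(1)] assms(2)[OF assms(1)] by simp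
qed

lemma revolved_circle_axis:
  assumes "r = 0 \<or> r = \<infinity>"
  shows "revolved_circle R r = range zpt"
proof -
  have "profile_circle R r = {(0, z) | z. True}" using assms by (auto simp: profile_circle_def)
  then have "revolved_circle R r = {zpt z | \<theta> z. \<theta> \<in> {0..2 * pi}}"
    by (simp add: revolved_circle_def)
  also have "\<dots> = range zpt" by (auto intro: exI[of _ 0])
  finally show ?thesis .
qed

lemma inverted_torus_shape_axis:
  assumes "1 < R" "r = 0 \<or> r = \<infinity>"
  shows "inverted_torus_shape R r = shape (inversion (xpt 0) ` torus R)"
  using shape_inverted_torus_axis[OF assms(1)] revolved_circle_axis[OF assms(2), of R]
  by (intro inverted_torus_shape_eqI[of "zpt 0"]) auto

lemma inverted_torus_shape_real:
  assumes "1 < R" "0 \<le> r" "r \<noteq> R - 1" "r \<noteq> R + 1"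
  shows "inverted_torus_shape R (ereal r) = shape (inversion (xpt r) ` torus R)"
proof (cases "r = 0")
  case True
  then show ?thesis using inverted_torus_shape_axis[OF assms(1)] by (simp add: zero_ereal_def)
next
  case False
  then have "r > 0" using assms by simp
  have "(r, 0) \<in> profile_circle R (ereal r)" using profile_circle_iff[OF \<open>0 < r\<close>] by simp
  then have "xpt r \<in> revolved_circle R (ereal r)"
    unfolding revolved_circle_def by (intro CollectI exI[of _ r] exI[of _ 0]) simp
  then show ?thesis
    using shape_inverted_torus_level[OF \<open>1 < R\<close> \<open>0 < r\<close> assms(3,4)
        revolved_circle_level[OF \<open>1 < R\<close> \<open>0 < r\<close>]]
    by (rule inverted_torus_shape_eqI)
qed

section \<open>The Clifford torus\<close>

text \<open>Here R^2 - 1 = 1, and in the coordinates X = 2 x / (|x|^2 + 1) of the 3-sphere the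
  equation reads X1^2 + X2^2 = 1/2.\<close>

lemma mem_torus_sqrt2_iff:
  "x \<in> torus (sqrt 2) \<longleftrightarrow> ((norm x)\<^sup>2 + 1)\<^sup>2 = 8 * ((x$1)\<^sup>2 + (x$2)\<^sup>2)"
proof -
  have "x \<in> torus (sqrt 2) \<longleftrightarrow> (norm x)\<^sup>2 + 1 = 2 * sqrt 2 * sqrt ((x$1)\<^sup>2 + (x$2)\<^sup>2)"
    by (subst mem_torus_iff) (simp_all add: algebra_simps)
  also have "\<dots> \<longleftrightarrow> ((norm x)\<^sup>2 + 1)\<^sup>2 = (2 * sqrt 2 * sqrt ((x$1)\<^sup>2 + (x$2)\<^sup>2))\<^sup>2"
    by (rule power2_eq_iff_nonneg[symmetric]) simp_all
  also have "(2 * sqrt 2 * sqrt ((x$1)\<^sup>2 + (x$2)\<^sup>2))\<^sup>2 = 8 * ((x$1)\<^sup>2 + (x$2)\<^sup>2)"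
    by (simp add: power_mult_distrib)
  finally show ?thesis .
qed

definition xz_swap :: "real^3 \<Rightarrow> real^3" where
  "xz_swap x = vector [x$3, x$2, x$1]"

lemma xz_swap_swap: "xz_swap (xz_swap x) = x"
  by (simp add: xz_swap_def vec_eq_iff forall_3)

lemma orthogonal_xz_swap: "orthogonal_transformation xz_swap"
proof -
  have "linear xz_swap"
    by (intro linearI) (simp_all add: xz_swap_def vec_eq_iff forall_3)
  moreover have "norm (xz_swap x) = norm x" for x
  proof -
    have "(norm (xz_swap x))\<^sup>2 = (norm x)\<^sup>2" unfolding norm_sq_3 by (simp add: xz_swap_def)
    then show ?thesis by simp
  qed
  ultimately show ?thesis unfolding orthogonal_transformation by blast
qed

text \<open>Under stereographic projection from the last coordinate of the 3-sphere, the inversion exchanges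
  the second and fourth coordinates and \<open>xz_swap\<close> the first and third. Together they exchange the two
  sides of the Clifford torus.\<close>

lemma clifford_inversion:
  fixes x :: "real^3"
  defines "q \<equiv> vector [0, 1, 0]"
  assumes "x \<noteq> q"
  shows "sphere_inversion q 2 x $ 1 = 2 * x$1 / (norm (x - q))\<^sup>2"
    "sphere_inversion q 2 x $ 2 = ((norm x)\<^sup>2 - 1) / (norm (x - q))\<^sup>2"
    "sphere_inversion q 2 x $ 3 = 2 * x$3 / (norm (x - q))\<^sup>2"
    "(norm (sphere_inversion q 2 x))\<^sup>2 + 1 = 2 * ((norm x)\<^sup>2 + 1) / (norm (x - q))\<^sup>2"
proof -
  define M where "M = (norm (x - q))\<^sup>2"
  define N where "N = (norm x)\<^sup>2"
  have M: "M \<noteq> 0" using assms by (simp add: M_def)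
  have N: "N = (x$1)\<^sup>2 + (x$2)\<^sup>2 + (x$3)\<^sup>2" by (simp add: N_def norm_sq_3)
  have MN: "M = N + 1 - 2 * x$2"
    unfolding M_def N norm_sq_3 by (simp add: q_def power2_eq_square algebra_simps)
  have y1: "sphere_inversion q 2 x $ 1 = 2 * x$1 / M"
    and y3: "sphere_inversion q 2 x $ 3 = 2 * x$3 / M"
    by (simp_all add: sphere_inversion_def M_def[symmetric]) (simp_all add: q_def)
  have "sphere_inversion q 2 x $ 2 = 1 + 2 / M * (x$2 - 1)"
    by (simp add: sphere_inversion_def M_def[symmetric]) (simp add: q_def)
  also have "\<dots> = (N - 1) / M"
    using M by (simp add: field_simps) (simp add: MN)
  finally have y2: "sphere_inversion q 2 x $ 2 = (N - 1) / M" .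
  have "(norm (sphere_inversion q 2 x))\<^sup>2 = ((2 * x$1)\<^sup>2 + (N - 1)\<^sup>2 + (2 * x$3)\<^sup>2) / M\<^sup>2"
    by (simp add: norm_sq_3[of "sphere_inversion q 2 x"] y1 y2 y3 power_divide add_divide_distrib)
  also have "(2 * x$1)\<^sup>2 + (N - 1)\<^sup>2 + (2 * x$3)\<^sup>2 = 4 * N - 4 * (x$2)\<^sup>2 + (N - 1)\<^sup>2"
    by (simp add: N power_mult_distrib)
  also have "\<dots> = (N + 1 + 2 * x$2) * M"
    unfolding MN by (simp add: power2_eq_square algebra_simps)
  finally have "(norm (sphere_inversion q 2 x))\<^sup>2 = (N + 1 + 2 * x$2) / M"
    using M by (simp add: power2_eq_square)
  then have "(norm (sphere_inversion q 2 x))\<^sup>2 + 1 = (N + 1 + 2 * x$2 + M) / M"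
    using M by (simp add: add_divide_distrib)
  also have "N + 1 + 2 * x$2 + M = 2 * (N + 1)" by (simp add: MN)
  finally show "(norm (sphere_inversion q 2 x))\<^sup>2 + 1 = 2 * ((norm x)\<^sup>2 + 1) / (norm (x - q))\<^sup>2"
    by (simp add: N_def M_def)
  show "sphere_inversion q 2 x $ 1 = 2 * x$1 / (norm (x - q))\<^sup>2"
    "sphere_inversion q 2 x $ 2 = ((norm x)\<^sup>2 - 1) / (norm (x - q))\<^sup>2"
    "sphere_inversion q 2 x $ 3 = 2 * x$3 / (norm (x - q))\<^sup>2"
    using y1 y2 y3 by (simp_all add: N_def M_def)
qed

text \<open>On the 3-sphere the two images are X1^2 + X4^2 = 1/2 and X2^2 + X3^2 = 1/2, which agree
  because the four squares add up to 1.\<close>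

lemma clifford_inversion_torus:
  "sphere_inversion (vector [0, 1, 0]) 2 ` torus (sqrt 2) = xz_swap ` torus (sqrt 2)"
proof (rule set_eqI)
  fix x :: "real^3"
  define q :: "real^3" where "q = vector [0, 1, 0]"
  have q: "q \<notin> torus (sqrt 2)" by (simp add: mem_torus_sqrt2_iff norm_sq_3 q_def)
  have swap: "x \<in> xz_swap ` torus (sqrt 2) \<longleftrightarrow> xz_swap x \<in> torus (sqrt 2)"
    using xz_swap_swap by (metis image_iff)
  have "sphere_inversion q 2 x \<in> torus (sqrt 2) \<longleftrightarrow> xz_swap x \<in> torus (sqrt 2)"
  proof (cases "x = q")
    case True
    then have "sphere_inversion q 2 x = q" "xz_swap x = q"
      by (simp_all add: sphere_inversion_def xz_swap_def q_def vec_eq_iff forall_3)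
    then show ?thesis by simp
  next
    case False
    define M where "M = (norm (x - q))\<^sup>2"
    define N where "N = (norm x)\<^sup>2"
    have M: "M \<noteq> 0" using False by (simp add: M_def)
    have N: "N = (x$1)\<^sup>2 + (x$2)\<^sup>2 + (x$3)\<^sup>2" by (simp add: N_def norm_sq_3)
    have "(norm (xz_swap x))\<^sup>2 = N" unfolding N norm_sq_3 by (simp add: xz_swap_def)
    then have r: "xz_swap x \<in> torus (sqrt 2) \<longleftrightarrow> (N + 1)\<^sup>2 = 8 * ((x$2)\<^sup>2 + (x$3)\<^sup>2)"
      by (simp add: mem_torus_sqrt2_iff) (simp add: xz_swap_def add.commute)
    have "sphere_inversion q 2 x \<in> torus (sqrt 2)
      \<longleftrightarrow> (2 * (N + 1) / M)\<^sup>2 = 8 * ((2 * x$1 / M)\<^sup>2 + ((N - 1) / M)\<^sup>2)"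
      unfolding mem_torus_sqrt2_iff q_def clifford_inversion[OF False[unfolded q_def]]
      by (simp add: M_def N_def q_def)
    also have "\<dots> \<longleftrightarrow> 4 * (N + 1)\<^sup>2 = 8 * (4 * (x$1)\<^sup>2 + (N - 1)\<^sup>2)"
      unfolding power_divide power_mult_distrib add_divide_distrib[symmetric] using M by simp
    also have "\<dots> \<longleftrightarrow> (N + 1)\<^sup>2 = 8 * (N - (x$1)\<^sup>2)"
    proof -
      have "8 * (4 * (x$1)\<^sup>2 + (N - 1)\<^sup>2) - 4 * (N + 1)\<^sup>2 = 4 * ((N + 1)\<^sup>2 - 8 * (N - (x$1)\<^sup>2))"
        by (simp add: power2_eq_square algebra_simps)
      moreover have "b - a = 4 * (c - d) \<Longrightarrow> a = b \<longleftrightarrow> c = d" for a b c d :: real by auto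
      ultimately show ?thesis by blast
    qed
    also have "\<dots> \<longleftrightarrow> xz_swap x \<in> torus (sqrt 2)" by (simp add: r) (simp add: N)
    finally show ?thesis .
  qed
  then show "x \<in> sphere_inversion (vector [0, 1, 0]) 2 ` torus (sqrt 2)
    \<longleftrightarrow> x \<in> xz_swap ` torus (sqrt 2)"
    unfolding swap by (simp add: sphere_inversion_image_iff q_def)
qed

lemma shape_clifford_swap:
  assumes "p \<notin> torus (sqrt 2)" "p \<noteq> vector [0, 1, 0]"
  shows "shape (inversion (xz_swap (sphere_inversion (vector [0, 1, 0]) 2 p)) ` torus (sqrt 2))
    = shape (inversion p ` torus (sqrt 2))"
proof -
  have "(vector [0, 1, 0] :: real^3) \<notin> torus (sqrt 2)"
    by (simp add: mem_torus_sqrt2_iff norm_sq_3)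
  then have "shape (inversion (sphere_inversion (vector [0, 1, 0]) 2 p) ` (xz_swap ` torus (sqrt 2)))
    = shape (inversion p ` torus (sqrt 2))"
    using shape_inversion_sphere_inversion[of 2 p "vector [0, 1, 0]" "torus (sqrt 2)"] assms
    unfolding clifford_inversion_torus by simp
  moreover have "xz_swap ` (xz_swap ` torus (sqrt 2)) = torus (sqrt 2)"
    by (simp add: image_image xz_swap_swap)
  ultimately show ?thesis
    using shape_inversion_orthogonal[OF orthogonal_xz_swap] by metis
qed

section \<open>Reduction of the Clifford case to parameters below \<open>sqrt 2 - 1\<close>\<close>

lemma level_parameter:
  assumes "2 \<le> (w :: real)"
  obtains r where "0 < r" "r \<le> 1" "r\<^sup>2 + 1 = w * r" "r + 1 / r = w"
proof -
  define d where "d = sqrt (w\<^sup>2 - 4)"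
  have "w\<^sup>2 \<ge> 4" using power_mono[OF assms, of 2] by simp
  then have d: "d \<ge> 0" "d\<^sup>2 = w\<^sup>2 - 4" by (simp_all add: d_def)
  have "d < w"
    using d assms by (intro power2_less_imp_less[of d w]) auto
  have "w - 2 \<le> d"
  proof (rule power2_le_imp_le)
    show "(w - 2)\<^sup>2 \<le> d\<^sup>2" using assms unfolding d(2) by (simp add: power2_eq_square algebra_simps)
  qed (rule d)
  \<comment> \<open>The smaller root of r^2 - w r + 1. The roots have product 1, so this one is at
    most 1.\<close>
  define r where "r = (w - d) / 2"
  have r: "0 < r" "r \<le> 1" using \<open>d < w\<close> \<open>w - 2 \<le> d\<close> by (simp_all add: r_def)
  have "r\<^sup>2 + 1 = w * r"
    using d(2) by (simp add: r_def power2_eq_square field_simps)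
  moreover from this have "r + 1 / r = w" using r by (simp add: field_simps power2_eq_square)
  ultimately show thesis using that r by blast
qed

lemma sqrt2_facts: "(2 * sqrt 2)\<^sup>2 = (8 :: real)" "2 < 2 * sqrt (2 :: real)"
  by (simp_all add: power_mult_distrib algebra_simps)

text \<open>\<open>2 * sqrt 2\<close> is the level of the torus itself, so \<open>p\<close> is
  outside the tube. On the axis the level is infinite, whence the separate case.\<close>

lemma shape_outside:
  assumes "(norm p)\<^sup>2 + 1 > 2 * sqrt 2 * sqrt ((p$1)\<^sup>2 + (p$2)\<^sup>2)"
  obtains r where "0 \<le> r" "r < sqrt 2 - 1"
    "shape (inversion p ` torus (sqrt 2)) = shape (inversion (xpt r) ` torus (sqrt 2))"
proof (cases "(p$1)\<^sup>2 + (p$2)\<^sup>2 = 0")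
  case True
  then have "p = zpt (p$3)" by (simp add: vec_eq_iff forall_3)
  then show thesis
    using shape_inverted_torus_axis[of "sqrt 2" "p$3"] that[of 0] sqrt2_facts by simp
next
  case False
  define \<rho> where "\<rho> = sqrt ((p$1)\<^sup>2 + (p$2)\<^sup>2)"
  have "\<rho> > 0"
    using False zero_le_power2[of "p$1"] zero_le_power2[of "p$2"] by (simp add: \<rho>_def less_le)
  define w where "w = ((norm p)\<^sup>2 + 1) / \<rho>"
  have w: "w > 2 * sqrt 2" using assms \<open>\<rho> > 0\<close> by (simp add: w_def pos_less_divide_eq flip: \<rho>_def)
  have "2 \<le> w" using w sqrt2_facts by linarith
  then obtain r where r: "0 < r" "r \<le> 1" "r\<^sup>2 + 1 = w * r" "r + 1 / r = w"
    by (rule level_parameter)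
  have "r < sqrt 2 - 1"
  proof (rule ccontr)
    assume "\<not> r < sqrt 2 - 1"
    moreover have "r < sqrt 2 + 1" using r(2) sqrt2_facts by linarith
    ultimately have "(r - (sqrt 2 - 1)) * (r - (sqrt 2 + 1)) \<le> 0"
      by (intro mult_nonneg_nonpos) simp_all
    also have "(r - (sqrt 2 - 1)) * (r - (sqrt 2 + 1)) = (w - 2 * sqrt 2) * r"
      using r(3) by (simp add: power2_eq_square algebra_simps)
    finally show False using w r(1) by (simp add: mult_le_0_iff)
  qed
  moreover have "(norm p)\<^sup>2 + (sqrt 2)\<^sup>2 - 1 = (r + ((sqrt 2)\<^sup>2 - 1) / r) * sqrt ((p$1)\<^sup>2 + (p$2)\<^sup>2)"
    using \<open>\<rho> > 0\<close> r(4) by (simp add: w_def flip: \<rho>_def)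
  ultimately show thesis
    using shape_inverted_torus_level[of "sqrt 2" r p] r(1) that[of r] by simp
qed

text \<open>A point within the tube is moved to \<open>xpt r\<close> on its own level and then
  across the torus by the extra symmetry, which leads back to \<open>shape_outside\<close>.\<close>

lemma shape_clifford:
  assumes "p \<notin> torus (sqrt 2)"
  obtains r where "0 \<le> r" "r < sqrt 2 - 1"
    "shape (inversion p ` torus (sqrt 2)) = shape (inversion (xpt r) ` torus (sqrt 2))"
proof (cases "(norm p)\<^sup>2 + 1 > 2 * sqrt 2 * sqrt ((p$1)\<^sup>2 + (p$2)\<^sup>2)")
  case True
  then show thesis by (rule shape_outside) (rule that)
next
  case False
  define \<rho> where "\<rho> = sqrt ((p$1)\<^sup>2 + (p$2)\<^sup>2)"
  have "(norm p)\<^sup>2 + 1 \<noteq> 2 * sqrt 2 * \<rho>"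
    using assms by (simp add: mem_torus_iff \<rho>_def algebra_simps)
  with False have lt: "(norm p)\<^sup>2 + 1 < 2 * sqrt 2 * \<rho>" by (simp add: \<rho>_def)
  have "0 \<le> (norm p)\<^sup>2" by simp
  then have "0 < 2 * sqrt 2 * \<rho>" using lt by linarith
  then have "\<rho> > 0" by (simp add: zero_less_mult_iff)
  have "\<rho>\<^sup>2 \<le> (norm p)\<^sup>2" by (simp add: \<rho>_def norm_sq_3)
  moreover have "2 * \<rho> \<le> \<rho>\<^sup>2 + 1" using zero_le_power2[of "\<rho> - 1"] by (simp add: power2_diff)
  ultimately have ge: "2 * \<rho> \<le> (norm p)\<^sup>2 + 1" by linarith
  define w where "w = ((norm p)\<^sup>2 + 1) / \<rho>"
  have w: "w < 2 * sqrt 2" "2 \<le> w"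
    using lt ge \<open>\<rho> > 0\<close> by (simp_all add: w_def pos_divide_less_eq pos_le_divide_eq)
  obtain r where r: "0 < r" "r \<le> 1" "r\<^sup>2 + 1 = w * r" "r + 1 / r = w"
    using level_parameter[OF w(2)] by blast
  have lev: "r + ((sqrt 2)\<^sup>2 - 1) / r \<noteq> 2 * sqrt 2" using r(4) w by simp
  then have rn: "r \<noteq> sqrt 2 - 1" "r \<noteq> sqrt 2 + 1"
    using torus_parameter_iff[of r "sqrt 2"] r(1) by auto
  have "(norm p)\<^sup>2 + (sqrt 2)\<^sup>2 - 1 = (r + ((sqrt 2)\<^sup>2 - 1) / r) * sqrt ((p$1)\<^sup>2 + (p$2)\<^sup>2)"
    using \<open>\<rho> > 0\<close> r(4) by (simp add: w_def flip: \<rho>_def)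
  then have 1: "shape (inversion p ` torus (sqrt 2)) = shape (inversion (xpt r) ` torus (sqrt 2))"
    using shape_inverted_torus_level[of "sqrt 2" r p] r(1) rn by simp
  define q :: "real^3" where "q = vector [0, 1, 0]"
  have "xpt r $ 2 \<noteq> q $ 2" by (simp add: q_def)
  then have "xpt r \<noteq> q" by metis
  define p' where "p' = xz_swap (sphere_inversion q 2 (xpt r))"
  have 2: "shape (inversion p' ` torus (sqrt 2)) = shape (inversion (xpt r) ` torus (sqrt 2))"
    unfolding p'_def q_def
    using r(1) rn \<open>xpt r \<noteq> q\<close> by (intro shape_clifford_swap) (auto simp: xpt_mem_torus_iff q_def)
  have M: "(norm (xpt r - q))\<^sup>2 = r\<^sup>2 + 1" "(norm (xpt r))\<^sup>2 = r\<^sup>2"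
    by (simp_all add: norm_sq_3 q_def)
  note ci = clifford_inversion[of "xpt r", folded q_def, OF \<open>xpt r \<noteq> q\<close>, unfolded M]
  have r2: "r\<^sup>2 + 1 > 0" by (simp add: add_nonneg_pos)
  have "(norm p')\<^sup>2 = (norm (sphere_inversion q 2 (xpt r)))\<^sup>2"
    unfolding p'_def norm_sq_3 by (simp add: xz_swap_def)
  also have "\<dots> = 1"
  proof -
    have "2 * (r\<^sup>2 + 1) / (r\<^sup>2 + 1) = 2" using r2 by (intro nonzero_mult_div_cancel_right) linarith
    then show ?thesis using ci(4) by linarith
  qed
  finally have "(norm p')\<^sup>2 = 1" .
  moreover have "p'$1 = 0" "p'$2 = (r\<^sup>2 - 1) / (r\<^sup>2 + 1)"
    unfolding p'_def by (simp_all add: xz_swap_def ci)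
  \<comment> \<open>This amounts to 2 (r^2 - 1)^2 < (r^2 + 1)^2. By the level equation the squares
    are (w^2 - 4) r^2 and w^2 r^2, so it is just w^2 < 8.\<close>
  moreover have "2 * sqrt 2 * (\<bar>r\<^sup>2 - 1\<bar> / (r\<^sup>2 + 1)) < 2"
  proof -
    have "w\<^sup>2 < (2 * sqrt 2)\<^sup>2" using w by (intro power_strict_mono) simp_all
    then have "w\<^sup>2 < 8" unfolding sqrt2_facts(1) .
    have "(r\<^sup>2 - 1)\<^sup>2 = (r\<^sup>2 + 1)\<^sup>2 - 4 * r\<^sup>2"
      by (simp add: power2_eq_square algebra_simps)
    then have "2 * (r\<^sup>2 - 1)\<^sup>2 = (2 * w\<^sup>2 - 8) * r\<^sup>2"
      unfolding r(3) power_mult_distrib by (simp add: algebra_simps)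
    also have "\<dots> < w\<^sup>2 * r\<^sup>2"
      using \<open>w\<^sup>2 < 8\<close> r(1) by (intro mult_strict_right_mono) simp_all
    also have "\<dots> = (r\<^sup>2 + 1)\<^sup>2" unfolding r(3) power_mult_distrib ..
    finally have "(sqrt 2 * \<bar>r\<^sup>2 - 1\<bar>)\<^sup>2 < (r\<^sup>2 + 1)\<^sup>2"
      unfolding power_mult_distrib power2_abs by simp
    then have "sqrt 2 * \<bar>r\<^sup>2 - 1\<bar> < r\<^sup>2 + 1"
      by (rule power2_less_imp_less) (use r2 in linarith)
    then have "sqrt 2 * \<bar>r\<^sup>2 - 1\<bar> / (r\<^sup>2 + 1) < 1" using r2 by (subst divide_less_eq_1_pos)
    then show ?thesis by simp
  qed
  ultimately have "(norm p')\<^sup>2 + 1 > 2 * sqrt 2 * sqrt ((p'$1)\<^sup>2 + (p'$2)\<^sup>2)"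
    using r2 by (simp add: abs_divide)
  then obtain r' where "0 \<le> r'" "r' < sqrt 2 - 1"
    "shape (inversion p' ` torus (sqrt 2)) = shape (inversion (xpt r') ` torus (sqrt 2))"
    by (rule shape_outside)
  then show thesis using that[of r'] unfolding 1 2 by blast
qed

section \<open>Distinctness of shapes\<close>

text \<open>The quotient of the two equations for the radii eliminates the scale. As
  \<open>K r - k r\<close> is the constant 4 R, the ratio of \<open>K r\<close> to
  \<open>k r\<close> determines \<open>k r\<close>, hence r^2.\<close>

lemma inverted_torus_shape_outer_inj:
  assumes "1 < R" "0 \<le> r" "r < R - 1" "0 \<le> r'" "r' < R - 1"
    and eq: "shape (inversion (xpt r) ` torus R) = shape (inversion (xpt r') ` torus R)"
  shows "r = r'"
proof -
  define k where "k = (\<lambda>r. (R - 1)\<^sup>2 - r\<^sup>2)"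
  define K where "K = (\<lambda>r. (R + 1)\<^sup>2 - r\<^sup>2)"
  have k: "k r > 0" "k r' > 0" "K r > 0" "K r' > 0"
    using assms by (simp_all add: k_def K_def power_strict_mono)
  obtain c where c: "(R - 1) / k r' = c * ((R - 1) / k r)" "(R + 1) / K r' = c * ((R + 1) / K r)"
    using shape_eq_two_circles[OF eq inverted_torus_outer[OF assms(1-3)] inverted_torus_outer[OF assms(1,4,5)]]
    unfolding k_def K_def by blast
  have "(R - 1) * k r = (R - 1) * (c * k r')" "(R + 1) * K r = (R + 1) * (c * K r')"
    using c k by (simp_all add: field_simps)
  then have "k r = c * k r'" "K r = c * K r'" using \<open>1 < R\<close> by auto
  then have "k r * K r' = k r' * K r" by simp
  then have "4 * R * (r'\<^sup>2 - r\<^sup>2) = 0"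
    by (simp add: k_def K_def power2_eq_square algebra_simps)
  then show ?thesis using assms by simp
qed

text \<open>With w = r + (R^2 - 1) / r, \<open>k r\<close> is r (2 R - w) and \<open>K r\<close> is
  r (2 R + w). The ratio of the radii thus determines w, which r shares with (R^2 - 1) / r; the
  bound \<open>sqrt (R\<^sup>2 - 1)\<close> selects one of the two.\<close>

lemma inverted_torus_shape_inner_inj:
  assumes "1 < R" "R - 1 < r" "r \<le> sqrt (R\<^sup>2 - 1)" "R - 1 < r'" "r' \<le> sqrt (R\<^sup>2 - 1)"
    and eq: "shape (inversion (xpt r) ` torus R) = shape (inversion (xpt r') ` torus R)"
  shows "r = r'"
proof -
  have "sqrt (R\<^sup>2 - 1) < R" using \<open>1 < R\<close> by (intro real_less_lsqrt) simp_all
  define k where "k = (\<lambda>r. 1 - (r - R)\<^sup>2)"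
  define K where "K = (\<lambda>r. (r + R)\<^sup>2 - 1)"
  have r: "0 < r" "0 < r'" "r < R + 1" "r' < R + 1" using assms \<open>sqrt (R\<^sup>2 - 1) < R\<close> by linarith+
  have k: "k r > 0" "k r' > 0" "K r > 0" "K r' > 0"
    using assms r by (simp_all add: k_def K_def abs_square_less_1)
  obtain c where c: "1 / k r' = c * (1 / k r)" "1 / K r' = c * (1 / K r)"
    using shape_eq_two_circles[OF eq inverted_torus_inner[OF assms(1,2) r(3)] inverted_torus_inner[OF assms(1,4) r(4)]]
    unfolding k_def K_def by blast
  have "k r = c * k r'" "K r = c * K r'"
    using c k by (simp_all add: field_simps)
  then have "k r * K r' = k r' * K r" by simp
  then have "4 * R * ((r - r') * (R\<^sup>2 - 1 - r * r')) = 0"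
    by (simp add: k_def K_def power2_eq_square algebra_simps)
  then consider "r = r'" | "r * r' = R\<^sup>2 - 1" using \<open>1 < R\<close> by auto
  then show ?thesis
  proof cases
    case 2
    define s where "s = sqrt (R\<^sup>2 - 1)"
    have "s\<^sup>2 = R\<^sup>2 - 1" using \<open>1 < R\<close> by (simp add: s_def)
    then have ss: "r * r' = s * s" using 2 by (simp add: power2_eq_square)
    have "s > 0" "r \<le> s" "r' \<le> s" using assms r by (simp_all add: s_def)
    then have "r * r' \<le> r * s" "r * r' \<le> s * r'" using r by simp_all
    then have "s * s \<le> r * s" "s * s \<le> s * r'" unfolding ss .
    then show ?thesis using \<open>s > 0\<close> \<open>r \<le> s\<close> \<open>r' \<le> s\<close> by simp
  qed
qed

text \<open>On both sides the ratio of the second radius to the first tends to 0 at r = R - 1, so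
  the radii alone cannot separate the sides. The distance d of the centres enters through the
  inversive distance (A^2 + B^2 - d^2) / (2 A B), which is also unchanged by scaling.\<close>

lemma inverted_torus_shape_outer_neq_inner:
  assumes "1 < R" "R \<noteq> sqrt 2" "0 \<le> r" "r < R - 1" "R - 1 < r'" "r' \<le> sqrt (R\<^sup>2 - 1)"
  shows "shape (inversion (xpt r) ` torus R) \<noteq> shape (inversion (xpt r') ` torus R)"
proof
  assume eq: "shape (inversion (xpt r) ` torus R) = shape (inversion (xpt r') ` torus R)"
  have "sqrt (R\<^sup>2 - 1) < R" using \<open>1 < R\<close> by (intro real_less_lsqrt) simp_all
  define k where "k = (R - 1)\<^sup>2 - r\<^sup>2"
  define K where "K = (R + 1)\<^sup>2 - r\<^sup>2"
  define k' where "k' = 1 - (r' - R)\<^sup>2"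
  define K' where "K' = 1 - (r' + R)\<^sup>2"
  have r: "0 < r'" "r' < R + 1" using assms \<open>sqrt (R\<^sup>2 - 1) < R\<close> by linarith+
  have k: "k > 0" "K > 0" "k' > 0" "K' < 0"
    using assms r by (simp_all add: k_def K_def k'_def K'_def power_strict_mono abs_square_less_1)
  have K'': "(r' + R)\<^sup>2 - 1 = - K'" by (simp add: K'_def)
  obtain c where c: "c > 0" "1 / k' = c * ((R - 1) / k)" "1 / (- K') = c * ((R + 1) / K)"
    and d: "dist (xpt r' + (1 / k') *\<^sub>R xpt (r' - R)) (xpt r' + (1 / K') *\<^sub>R xpt (r' + R))
      = c * dist (xpt r + (1 / k) *\<^sub>R xpt r) (xpt r + (1 / K) *\<^sub>R xpt r)"
    using shape_eq_two_circles[OF eq inverted_torus_outer[OF assms(1,3,4)]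
        inverted_torus_inner[OF assms(1,5) r(2)]]
    unfolding K'' k_def[symmetric] K_def[symmetric] k'_def[symmetric] K'_def[symmetric] by blast
  have dx: "(dist (xpt a + s *\<^sub>R xpt b) (xpt a + t *\<^sub>R xpt e))\<^sup>2 = (s * b - t * e)\<^sup>2" for a b s t e
    by (simp add: dist_norm norm_sq_3)
  have d2: "((r' - R) / k' - (r' + R) / K')\<^sup>2 = c\<^sup>2 * (r / k - r / K)\<^sup>2"
    using arg_cong[OF d, of power2] unfolding power_mult_distrib dx by simp
  \<comment> \<open>The inversive distance of the two circles is \<open>(R\<^sup>2 + 1) / (R\<^sup>2 - 1)\<close> in the outer case and
    \<open>2 R\<^sup>2 - 1\<close> in the inner one.\<close>
  have outer: "((R - 1) / k)\<^sup>2 + ((R + 1) / K)\<^sup>2 - (r / k - r / K)\<^sup>2 = (2 * R\<^sup>2 + 2) / (k * K)"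
  proof -
    have "((R - 1) / k)\<^sup>2 + ((R + 1) / K)\<^sup>2 - (r / k - r / K)\<^sup>2
      = (k + r\<^sup>2) / k\<^sup>2 + (K + r\<^sup>2) / K\<^sup>2 - (r / k - r / K)\<^sup>2"
      by (simp add: power_divide) (simp add: k_def K_def)
    also have "\<dots> = (k + K + 2 * r\<^sup>2) / (k * K)"
      using k by (simp add: field_simps power2_eq_square)
    also have "k + K + 2 * r\<^sup>2 = 2 * R\<^sup>2 + 2"
      by (simp add: k_def K_def power2_eq_square algebra_simps)
    finally show ?thesis .
  qed
  have inner: "(1 / k')\<^sup>2 + (1 / (- K'))\<^sup>2 - ((r' - R) / k' - (r' + R) / K')\<^sup>2
    = (2 - 4 * R\<^sup>2) / (k' * K')"
  proof -
    have "(1 / k')\<^sup>2 + (1 / (- K'))\<^sup>2 - ((r' - R) / k' - (r' + R) / K')\<^sup>2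
      = (k' + (r' - R)\<^sup>2) / k'\<^sup>2 + (K' + (r' + R)\<^sup>2) / K'\<^sup>2 - ((r' - R) / k' - (r' + R) / K')\<^sup>2"
      by (simp add: power_divide) (simp add: k'_def K'_def)
    also have "\<dots> = (k' + K' + 2 * (r' - R) * (r' + R)) / (k' * K')"
      using k by (simp add: field_simps power2_eq_square)
    also have "k' + K' + 2 * (r' - R) * (r' + R) = 2 - 4 * R\<^sup>2"
      by (simp add: k'_def K'_def power2_eq_square algebra_simps)
    finally show ?thesis .
  qed
  have "(2 - 4 * R\<^sup>2) / (k' * K') = c\<^sup>2 * ((2 * R\<^sup>2 + 2) / (k * K))"
    unfolding inner[symmetric] outer[symmetric] d2 c(2,3) power_mult_distrib
      right_diff_distrib distrib_left by simp
  moreover have "1 / (k' * K') = - c\<^sup>2 * ((R\<^sup>2 - 1) / (k * K))"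
  proof -
    have "1 / (k' * K') = - ((1 / k') * (1 / (- K')))" by simp
    also have "\<dots> = - c\<^sup>2 * ((R - 1) * (R + 1) / (k * K))"
      unfolding c(2,3) by (simp add: power2_eq_square)
    finally show ?thesis by (simp add: power2_eq_square algebra_simps)
  qed
  moreover have "(2 - 4 * R\<^sup>2) / (k' * K') = (2 - 4 * R\<^sup>2) * (1 / (k' * K'))" by simp
  ultimately have "c\<^sup>2 * ((2 * R\<^sup>2 + 2) / (k * K)) = (2 - 4 * R\<^sup>2) * (- c\<^sup>2 * ((R\<^sup>2 - 1) / (k * K)))"
    by simp
  also have "\<dots> = (4 * R\<^sup>2 - 2) * (c\<^sup>2 * ((R\<^sup>2 - 1) / (k * K)))"
    by (simp only: left_diff_distrib)
  finally have "c\<^sup>2 * ((2 * R\<^sup>2 + 2) / (k * K)) = (4 * R\<^sup>2 - 2) * (c\<^sup>2 * ((R\<^sup>2 - 1) / (k * K)))" .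
  \<comment> \<open>Freed from \<open>c\<close>, \<open>k\<close> and \<open>K\<close>, this equates
    the two inversive distances.\<close>
  then have "(2 * R\<^sup>2 + 2) = (4 * R\<^sup>2 - 2) * (R\<^sup>2 - 1)"
    using c(1) k(1,2) by (simp add: divide_simps)
  then have "4 * R\<^sup>2 * (R\<^sup>2 - 2) = 0" by (simp add: power2_eq_square algebra_simps)
  then have "R\<^sup>2 = 2" using assms(1) by simp
  then have "sqrt 2 = R" using assms(1) by (intro real_sqrt_unique) simp_all
  then show False using assms(2) by simp
qed

theorem theorem2p4:
  fixes R :: real
  assumes "1 < R"
  shows "inj_on (inverted_torus_shape R) {0..<ereal (R - 1)}
    \<and> (R \<noteq> sqrt 2 \<longrightarrow>
         inj_on (inverted_torus_shape R)
           ({0..<ereal (R - 1)} \<union> {ereal (R - 1)<..ereal (sqrt (R\<^sup>2 - 1))}))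
    \<and> (R = sqrt 2 \<longrightarrow>
         (\<forall>r. r > ereal (sqrt 2 - 1) \<and> r \<noteq> ereal (sqrt 2 + 1) \<longrightarrow>
            (\<exists>r' \<in> {0..<ereal (sqrt 2 - 1)}.
               inverted_torus_shape (sqrt 2) r = inverted_torus_shape (sqrt 2) r'))
         \<and> bij_betw (inverted_torus_shape (sqrt 2)) {0..<ereal (sqrt 2 - 1)}
             ({inversion p ` torus (sqrt 2) | p. p \<in> UNIV - torus (sqrt 2)} // homothetic))"
proof (intro conjI impI)
  define outer where "outer = {0..<ereal (R - 1)}"
  define inner where "inner = {ereal (R - 1)<..ereal (sqrt (R\<^sup>2 - 1))}"
  \<comment> \<open>Keeps the parameters in \<open>inner\<close> away from \<open>R + 1\<close>,
    where no common shape exists.\<close>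
  have "sqrt (R\<^sup>2 - 1) < R" using \<open>1 < R\<close> by (intro real_less_lsqrt) simp_all
  have outer: "\<exists>r. x = ereal r \<and> 0 \<le> r \<and> r < R - 1
      \<and> inverted_torus_shape R x = shape (inversion (xpt r) ` torus R)" if "x \<in> outer" for x
    using that inverted_torus_shape_real[OF \<open>1 < R\<close>] by (cases x) (auto simp: outer_def)
  have inner: "\<exists>r. x = ereal r \<and> R - 1 < r \<and> r \<le> sqrt (R\<^sup>2 - 1)
      \<and> inverted_torus_shape R x = shape (inversion (xpt r) ` torus R)" if "x \<in> inner" for x
    using that inverted_torus_shape_real[OF \<open>1 < R\<close>] \<open>1 < R\<close> \<open>sqrt (R\<^sup>2 - 1) < R\<close>
    by (cases x) (auto simp: inner_def)
  have inj_outer: "inj_on (inverted_torus_shape R) outer"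
  proof (rule inj_onI)
    fix x y assume "x \<in> outer" "y \<in> outer" and eq: "inverted_torus_shape R x = inverted_torus_shape R y"
    from outer[OF this(1)] outer[OF this(2)] show "x = y"
      using inverted_torus_shape_outer_inj[OF \<open>1 < R\<close>] eq by auto
  qed
  then show "inj_on (inverted_torus_shape R) {0..<ereal (R - 1)}" unfolding outer_def .
  show "inj_on (inverted_torus_shape R)
      ({0..<ereal (R - 1)} \<union> {ereal (R - 1)<..ereal (sqrt (R\<^sup>2 - 1))})" if "R \<noteq> sqrt 2"
  proof -
    have "inj_on (inverted_torus_shape R) inner"
    proof (rule inj_onI)
      fix x y assume "x \<in> inner" "y \<in> inner" and eq: "inverted_torus_shape R x = inverted_torus_shape R y"
      from inner[OF this(1)] inner[OF this(2)] show "x = y"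
        using inverted_torus_shape_inner_inj[OF \<open>1 < R\<close>] eq by auto
    qed
    moreover have "inverted_torus_shape R x \<noteq> inverted_torus_shape R y" if "x \<in> outer" "y \<in> inner" for x y
    proof -
      obtain r where r: "0 \<le> r" "r < R - 1" "inverted_torus_shape R x = shape (inversion (xpt r) ` torus R)"
        using outer[OF \<open>x \<in> outer\<close>] by blast
      obtain r' where r': "R - 1 < r'" "r' \<le> sqrt (R\<^sup>2 - 1)"
        "inverted_torus_shape R y = shape (inversion (xpt r') ` torus R)"
        using inner[OF \<open>y \<in> inner\<close>] by blast
      show ?thesis
        unfolding r(3) r'(3)
        by (rule inverted_torus_shape_outer_neq_inner[OF \<open>1 < R\<close> \<open>R \<noteq> sqrt 2\<close> r(1,2) r'(1,2)])
    qed
    ultimately show ?thesis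
      using inj_outer unfolding outer_def[symmetric] inner_def[symmetric] inj_on_def by (metis UnE)
  qed
  assume R: "R = sqrt 2"
  have outerI: "\<exists>r' \<in> outer. shape (inversion p ` torus (sqrt 2)) = inverted_torus_shape (sqrt 2) r'"
    if p: "p \<notin> torus (sqrt 2)" for p
  proof -
    obtain r where r: "0 \<le> r" "r < sqrt 2 - 1"
      "shape (inversion p ` torus (sqrt 2)) = shape (inversion (xpt r) ` torus (sqrt 2))"
      using shape_clifford[OF p] by blast
    then show ?thesis
      using inverted_torus_shape_real[OF \<open>1 < R\<close> r(1)] R by (intro bexI[of _ "ereal r"]) (auto simp: outer_def)
  qed
  show "\<forall>r. r > ereal (sqrt 2 - 1) \<and> r \<noteq> ereal (sqrt 2 + 1) \<longrightarrow>
      (\<exists>r' \<in> {0..<ereal (sqrt 2 - 1)}.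
         inverted_torus_shape (sqrt 2) r = inverted_torus_shape (sqrt 2) r')"
  proof (intro allI impI)
    fix x assume x: "x > ereal (sqrt 2 - 1) \<and> x \<noteq> ereal (sqrt 2 + 1)"
    have "\<exists>p. p \<notin> torus (sqrt 2) \<and> inverted_torus_shape (sqrt 2) x = shape (inversion p ` torus (sqrt 2))"
    proof (cases x)
      case (real r)
      then have r: "r > sqrt 2 - 1" "r \<noteq> sqrt 2 + 1" using x by auto
      then have "r \<ge> 0" using \<open>1 < R\<close> R by linarith
      then show ?thesis
        using r real inverted_torus_shape_real[OF \<open>1 < R\<close>, of r] xpt_mem_torus_iff[OF \<open>1 < R\<close>, of r]
        by (intro exI[of _ "xpt r"]) (simp add: R)
    next
      \<comment> \<open>The parameter \<infinity> stands for the axis, as 0 does.\<close>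
      case PInf
      then show ?thesis
        using inverted_torus_shape_axis[OF \<open>1 < R\<close>, of x] zpt_not_mem_torus[OF \<open>1 < R\<close>, of 0] R by auto
    qed (use x in auto)
    then obtain p where p: "p \<notin> torus (sqrt 2)"
      "inverted_torus_shape (sqrt 2) x = shape (inversion p ` torus (sqrt 2))" by blast
    show "\<exists>r' \<in> {0..<ereal (sqrt 2 - 1)}.
         inverted_torus_shape (sqrt 2) x = inverted_torus_shape (sqrt 2) r'"
      using outerI[OF p(1)] unfolding p(2) outer_def R .
  qed
  show "bij_betw (inverted_torus_shape (sqrt 2)) {0..<ereal (sqrt 2 - 1)}
      ({inversion p ` torus (sqrt 2) | p. p \<in> UNIV - torus (sqrt 2)} // homothetic)"
  proof (rule bij_betw_imageI)
    show "inj_on (inverted_torus_shape (sqrt 2)) {0..<ereal (sqrt 2 - 1)}"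
      using inj_outer unfolding outer_def R .
    \<comment> \<open>\<open>homothetic\<close> relates arbitrary subsets of the space, so each
      class in the quotient is a full shape.\<close>
    have Q: "{inversion p ` torus (sqrt 2) | p. p \<in> UNIV - torus (sqrt 2)} // homothetic
      = {shape (inversion p ` torus (sqrt 2)) | p. p \<notin> torus (sqrt 2)}"
      by (auto simp: quotient_def shape_def)
    have "xpt r \<notin> torus (sqrt 2)" if "0 \<le> r" "r < R - 1" for r
      using that xpt_mem_torus_iff[OF \<open>1 < R\<close>, of r] R by auto
    then have "inverted_torus_shape (sqrt 2) ` outer \<subseteq> {shape (inversion p ` torus (sqrt 2)) | p. p \<notin> torus (sqrt 2)}"
      using outer unfolding R by blast
    moreover have "{shape (inversion p ` torus (sqrt 2)) | p. p \<notin> torus (sqrt 2)} \<subseteq> inverted_torus_shape (sqrt 2) ` outer"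
      using outerI by auto
    ultimately show "inverted_torus_shape (sqrt 2) ` {0..<ereal (sqrt 2 - 1)}
      = {inversion p ` torus (sqrt 2) | p. p \<in> UNIV - torus (sqrt 2)} // homothetic"
      unfolding Q outer_def R by blast
  qed
qed

end
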